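(* For every $1\le p\le\infty$ and every $m>-d\left|\frac12-\frac1p\right|$ there exist a $C^\infty$ diffeomorphism $\varphi:\mathbb{R}\to\mathbb{R}$ satisfying $\varphi(t)=t$ for $|t|\ge1$, and a symbol $\sigma\in\mathbf{SG}^{-\infty,m}$ compactly supported with respect to $\eta$, such that the Fourier integral operator $$Af(x)=\int_{\mathbb{R}^d}e^{2\pi i\Phi(x,\eta)}\sigma(x,\eta)\hat f(\eta)\,d\eta,\qquad f\in\mathcal{S}(\mathbb{R}^d),\qquad \Phi(x,\eta)=\sum_{k=1}^d\varphi(\eta_k)x_k,$$ does not extend to a bounded operator on $L^p(\mathbb{R}^d)$ if $1\le p<\infty$, nor on the closure of the Schwartz space $\mathcal{S}(\mathbb{R}^d)$ in $L^\infty(\mathbb{R}^d)$ if $p=\infty$.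
   Context: The Fourier transform is $\hat f(\eta)=\int f(t)e^{-2\pi i t\cdot\eta}\,dt$; $\langle y\rangle=(1+|y|^2)^{1/2}$; $1/\infty=0$. For $m_1,m_2\in\mathbb{R}$, $\mathbf{SG}^{m_1,m_2}$ is the class of $\sigma\in C^\infty(\mathbb{R}^{2d})$ such that for all multi-indices $\alpha,\beta$ there is $C_{\alpha,\beta}$ with $$|\partial_\eta^\alpha\partial_x^\beta\sigma(x,\eta)|\le C_{\alpha,\beta}\langle\eta\rangle^{m_1-|\alpha|}\langle x\rangle^{m_2-|\beta|}\quad\text{for all }(x,\eta)\in\mathbb{R}^{2d};$$ $\mathbf{SG}^{-\infty,m}=\bigcap_{m_1\in\mathbb{R}}\mathbf{SG}^{m_1,m}$. A symbol is compactly supported with respect to $\eta$ if there is $R>0$ with $\sigma(x,\eta)=0$ whenever $|\eta|\ge R$. *)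

theory Defs
  imports "HOL-Probability.Essential_Supremum"
begin

definition dir_deriv ::
    "'a \<Rightarrow> ('a::euclidean_space \<Rightarrow> 'b::real_normed_vector) \<Rightarrow> 'a \<Rightarrow> 'b" where
  "dir_deriv v f = (\<lambda>x. frechet_derivative f (at x) v)"

primrec Ck :: "nat \<Rightarrow> ('a::euclidean_space \<Rightarrow> 'b::real_normed_vector) \<Rightarrow> bool" where
  "Ck 0 f \<longleftrightarrow> continuous_on UNIV f"
| "Ck (Suc k) f \<longleftrightarrow> f differentiable_on UNIV \<and> (\<forall>v. Ck k (dir_deriv v f))"

definition smooth :: "('a::euclidean_space \<Rightarrow> 'b::real_normed_vector) \<Rightarrow> bool" where
  "smooth f \<longleftrightarrow> (\<forall>k. Ck k f)"

definition smooth_diffeo :: "(real \<Rightarrow> real) \<Rightarrow> bool" where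
  "smooth_diffeo \<phi> \<longleftrightarrow> bij \<phi> \<and> smooth \<phi> \<and> smooth (inv \<phi>)"

text \<open>
  A multi-index \<open>\<alpha>\<close> is encoded as a list of coordinate indices in which \<open>i\<close> occurs
  \<open>\<alpha>\<^sub>i\<close> times, so its order \<open>|\<alpha>|\<close> is the length of the list; on smooth functions the order
  of the entries is immaterial. \<open>iter_deriv\<close> differentiates along a list of vectors.
\<close>

definition iter_deriv ::
    "'a list \<Rightarrow> ('a::euclidean_space \<Rightarrow> 'b::real_normed_vector) \<Rightarrow> 'a \<Rightarrow> 'b" where
  "iter_deriv vs f = foldr dir_deriv vs f"

definition partial :: "'n list \<Rightarrow> (real^'n \<Rightarrow> complex) \<Rightarrow> real^'n \<Rightarrow> complex" where
  "partial \<alpha> f = iter_deriv (map (\<lambda>i. axis i 1) \<alpha>) f"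

definition partial_fst ::
    "'n list \<Rightarrow> ((real^'n) \<times> (real^'n) \<Rightarrow> complex) \<Rightarrow> (real^'n) \<times> (real^'n) \<Rightarrow> complex" where
  "partial_fst \<alpha> f = iter_deriv (map (\<lambda>i. (axis i 1, 0)) \<alpha>) f"

definition partial_snd ::
    "'n list \<Rightarrow> ((real^'n) \<times> (real^'n) \<Rightarrow> complex) \<Rightarrow> (real^'n) \<times> (real^'n) \<Rightarrow> complex" where
  "partial_snd \<alpha> f = iter_deriv (map (\<lambda>i. (0, axis i 1)) \<alpha>) f"

definition jbracket :: "'a::real_normed_vector \<Rightarrow> real" where
  "jbracket y = sqrt (1 + (norm y)\<^sup>2)"

text \<open>Symbols are functions of the pair \<open>(x, \<eta>)\<close>, in this order.\<close>

definition SG :: "real \<Rightarrow> real \<Rightarrow> ((real^'n) \<times> (real^'n) \<Rightarrow> complex) set" where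
  "SG m1 m2 = {\<sigma>. smooth \<sigma> \<and>
     (\<forall>\<alpha> \<beta>. \<exists>C. \<forall>x \<eta>. cmod (partial_snd \<alpha> (partial_fst \<beta> \<sigma>) (x, \<eta>))
        \<le> C * jbracket \<eta> powr (m1 - real (length \<alpha>)) * jbracket x powr (m2 - real (length \<beta>)))}"

definition SG_minus_inf :: "real \<Rightarrow> ((real^'n) \<times> (real^'n) \<Rightarrow> complex) set" where
  "SG_minus_inf m = (\<Inter>m1. SG m1 m)"

definition compactly_supported_snd :: "((real^'n) \<times> (real^'n) \<Rightarrow> complex) \<Rightarrow> bool" where
  "compactly_supported_snd \<sigma> \<longleftrightarrow> (\<exists>R>0. \<forall>x \<eta>. norm \<eta> \<ge> R \<longrightarrow> \<sigma> (x, \<eta>) = 0)"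

definition schwartz :: "(real^'n \<Rightarrow> complex) set" where
  "schwartz = {f. smooth f \<and>
     (\<forall>N::nat. \<forall>\<alpha>. \<exists>C. \<forall>x. jbracket x ^ N * cmod (partial \<alpha> f x) \<le> C)}"

definition fourier :: "(real^'n \<Rightarrow> complex) \<Rightarrow> real^'n \<Rightarrow> complex" where
  "fourier f \<eta> = (LINT t|lborel. f t * exp (- 2 * pi * \<i> * (t \<bullet> \<eta>)))"

definition FIO ::
    "(real^'n \<Rightarrow> real^'n \<Rightarrow> real) \<Rightarrow> ((real^'n) \<times> (real^'n) \<Rightarrow> complex)
      \<Rightarrow> (real^'n \<Rightarrow> complex) \<Rightarrow> real^'n \<Rightarrow> complex" where
  "FIO \<Phi> \<sigma> f x = (LINT \<eta>|lborel. exp (2 * pi * \<i> * \<Phi> x \<eta>) * \<sigma> (x, \<eta>) * fourier f \<eta>)"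

text \<open>
  Elements of \<open>L\<^sup>p\<close> are represented by Borel functions rather than by classes modulo null sets;
  accordingly, identities between elements of \<open>L\<^sup>p\<close> are stated almost everywhere below.
\<close>

definition Lp_space :: "ennreal \<Rightarrow> (real^'n \<Rightarrow> complex) set" where
  "Lp_space p = {f \<in> borel_measurable lborel.
     if p = \<infinity> then esssup lborel (\<lambda>x. ennreal (cmod (f x))) < \<infinity>
     else integrable lborel (\<lambda>x. cmod (f x) powr enn2real p)}"

definition Lp_norm :: "ennreal \<Rightarrow> (real^'n \<Rightarrow> complex) \<Rightarrow> real" where
  "Lp_norm p f =
     (if p = \<infinity> then enn2real (esssup lborel (\<lambda>x. ennreal (cmod (f x))))
      else (LINT x|lborel. cmod (f x) powr enn2real p) powr (1 / enn2real p))"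

definition schwartz_closure_Linf :: "(real^'n \<Rightarrow> complex) set" where
  "schwartz_closure_Linf =
     {f \<in> Lp_space \<infinity>. \<forall>\<epsilon>>0. \<exists>g\<in>schwartz. Lp_norm \<infinity> (\<lambda>x. f x - g x) < \<epsilon>}"

text \<open>
  \<open>T\<close> is a bounded linear operator on the subspace \<open>V\<close> of \<open>L\<^sup>p\<close>. Functions that agree almost
  everywhere have images that agree almost everywhere, by linearity and boundedness.
\<close>

definition bounded_operator_on ::
    "ennreal \<Rightarrow> (real^'n \<Rightarrow> complex) set \<Rightarrow> ((real^'n \<Rightarrow> complex) \<Rightarrow> real^'n \<Rightarrow> complex) \<Rightarrow> bool"
  where
  "bounded_operator_on p V T \<longleftrightarrow>
     (\<forall>f\<in>V. T f \<in> V) \<and>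
     (\<forall>f\<in>V. \<forall>g\<in>V. AE x in lborel. T (\<lambda>y. f y + g y) x = T f x + T g x) \<and>
     (\<forall>c. \<forall>f\<in>V. AE x in lborel. T (\<lambda>y. c * f y) x = c * T f x) \<and>
     (\<exists>C. \<forall>f\<in>V. Lp_norm p (T f) \<le> C * Lp_norm p f)"

definition extends_to_bounded_operator_on ::
    "ennreal \<Rightarrow> (real^'n \<Rightarrow> complex) set \<Rightarrow> ((real^'n \<Rightarrow> complex) \<Rightarrow> real^'n \<Rightarrow> complex) \<Rightarrow> bool"
  where
  "extends_to_bounded_operator_on p V A \<longleftrightarrow>
     (\<exists>T. bounded_operator_on p V T \<and> (\<forall>f\<in>schwartz. AE x in lborel. T f x = A f x))"

end

theory Submission
  imports Defs "HOL-Complex_Analysis.Conformal_Mappings" "HOL-Probability.Characteristic_Functions"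
    "HOL-Real_Asymp.Real_Asymp"
begin

text \<open>
  Take \<open>\<phi>(s) = s + a s\<^sup>2\<close> near the origin, let \<open>\<psi>\<close> be a cutoff supported where \<open>\<phi>\<close> is quadratic, and put
  \<open>\<sigma>(x,\<eta>) = \<langle>x\<rangle>\<^sup>m \<Prod>\<^sub>k \<psi>(\<eta>\<^sub>k)\<close>. The operator is tested on the Gaussians
  \<open>f(t) = exp(-\<pi>|t - (l,\<dots>,l)|\<^sup>2/z)\<close> with complex \<open>z\<close>, \<open>Re z > 0\<close>: their Fourier transforms are explicit, and
  \<open>A f(x)\<close> is \<open>\<langle>x\<rangle>\<^sup>m\<close> times a product of one-dimensional integrals with quadratic phase.

  If \<open>p \<ge> 2\<close>, take \<open>z = 1 + 2ial\<close>. The chirp in the Fourier transform of \<open>f\<close> cancels the quadratic part of the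
  phase near \<open>x = (l,\<dots>,l)\<close>, so \<open>A\<close> focuses \<open>f\<close>, which is spread over a cube of side about \<open>l\<close>, into a unit
  cube; relative to \<open>\<parallel>f\<parallel>\<^sub>p\<close> this gains \<open>l\<close> to the power \<open>d(1/2 - 1/p)\<close>, while the weight contributes \<open>l\<^sup>m\<close>.

  If \<open>p < 2\<close>, take \<open>z = M\<close> real and \<open>l = M\<^sup>N\<close>. Now \<open>A\<close> spreads a narrow \<open>f\<close> over a cube of side about \<open>l\<close>,
  which gains \<open>l\<close> to the power \<open>d(1/p - 1/2)\<close>. Since the Fourier transform of \<open>f\<close> lives at scale \<open>M\<close> to the power
  \<open>-1/2\<close>, removing the cutoff costs only an exponentially small error, and the loss of powers of \<open>M\<close> is
  absorbed by the strict inequality for \<open>m\<close> once \<open>N\<close> is large.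
\<close>

section \<open>Differentiability classes\<close>

lemma dir_deriv_eq:
  assumes "\<And>x. (f has_derivative f' x) (at x)"
  shows "dir_deriv v f = (\<lambda>x. f' x v)"
  unfolding dir_deriv_def using frechet_derivative_at[OF assms] by metis

lemma Ck_SucI:
  assumes "\<And>x. (f has_derivative f' x) (at x)" "\<And>v. Ck k (\<lambda>x. f' x v)"
  shows "Ck (Suc k) f"
  using assms dir_deriv_eq[of f f', OF assms(1)]
  by (auto simp: differentiable_on_def differentiable_def intro: has_derivative_at_withinI)

lemma Ck_Suc_has_derivative:
  assumes "Ck (Suc k) f"
  shows "(f has_derivative (\<lambda>v. dir_deriv v f x)) (at x)"
proof -
  have "f differentiable (at x)"
    using assms by (auto simp: differentiable_on_def)
  thus ?thesis unfolding dir_deriv_def by (metis frechet_derivative_works)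
qed

lemma Ck_SucD: "Ck (Suc k) f \<Longrightarrow> Ck k f"
proof (induction k arbitrary: f)
  case 0
  thus ?case by (auto intro: differentiable_imp_continuous_on)
next
  case (Suc k)
  thus ?case using Ck.simps(2)[of "Suc k" f] Ck.simps(2)[of k f] by blast
qed

lemma smooth_has_derivative: "smooth f \<Longrightarrow> (f has_derivative (\<lambda>v. dir_deriv v f x)) (at x)"
  by (rule Ck_Suc_has_derivative[of 0]) (auto simp only: smooth_def)

lemma smooth_dir_deriv: "smooth f \<Longrightarrow> smooth (dir_deriv v f)"
  unfolding smooth_def using Ck.simps(2) by blast

lemma smooth_continuous_on: "smooth f \<Longrightarrow> continuous_on A f"
  unfolding smooth_def using Ck.simps(1) continuous_on_subset by blast

lemma Ck_const [simp]: "Ck k (\<lambda>x. c)"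
proof (induction k arbitrary: c)
  case (Suc k)
  show ?case by (rule Ck_SucI[where f'="\<lambda>x v. 0"]) (auto simp: Suc)
qed simp

lemma Ck_add: "Ck k f \<Longrightarrow> Ck k g \<Longrightarrow> Ck k (\<lambda>x. f x + g x)"
proof (induction k arbitrary: f g)
  case (Suc k)
  show ?case
  proof (rule Ck_SucI)
    show "((\<lambda>x. f x + g x) has_derivative (\<lambda>v. dir_deriv v f x + dir_deriv v g x)) (at x)" for x
      using Suc.prems by (intro has_derivative_add Ck_Suc_has_derivative)
    show "Ck k (\<lambda>x. dir_deriv v f x + dir_deriv v g x)" for v
      using Suc by auto
  qed
qed (simp add: continuous_on_add)

lemma Ck_bounded_linear:
  assumes "bounded_linear L"
  shows "Ck k f \<Longrightarrow> Ck k (\<lambda>x. L (f x))"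
proof (induction k arbitrary: f)
  case 0
  thus ?case using bounded_linear.continuous_on[OF assms] by simp
next
  case (Suc k)
  show ?case
  proof (rule Ck_SucI)
    show "((\<lambda>x. L (f x)) has_derivative (\<lambda>v. L (dir_deriv v f x))) (at x)" for x
      using Suc.prems by (intro bounded_linear.has_derivative[OF assms] Ck_Suc_has_derivative)
    show "Ck k (\<lambda>x. L (dir_deriv v f x))" for v
      using Suc by auto
  qed
qed

lemma Ck_bounded_bilinear:
  assumes "bounded_bilinear b"
  shows "Ck k f \<Longrightarrow> Ck k g \<Longrightarrow> Ck k (\<lambda>x. b (f x) (g x))"
proof (induction k arbitrary: f g)
  case 0
  thus ?case using bounded_bilinear.continuous_on[OF assms] by simp
next
  case (Suc k)
  show ?case
  proof (rule Ck_SucI)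
    show "((\<lambda>x. b (f x) (g x)) has_derivative
        (\<lambda>v. b (f x) (dir_deriv v g x) + b (dir_deriv v f x) (g x))) (at x)" for x
      using Suc.prems by (intro bounded_bilinear.FDERIV[OF assms] Ck_Suc_has_derivative)
    show "Ck k (\<lambda>x. b (f x) (dir_deriv v g x) + b (dir_deriv v f x) (g x))" for v
      using Suc.prems Ck_SucD[OF Suc.prems(1)] Ck_SucD[OF Suc.prems(2)] Suc.IH
      by (intro Ck_add) auto
  qed
qed

lemmas Ck_mult = Ck_bounded_bilinear[OF bounded_bilinear_mult]
lemmas Ck_scaleR = Ck_bounded_bilinear[OF bounded_bilinear_scaleR]
lemmas Ck_of_real = Ck_bounded_linear[OF bounded_linear_of_real]

lemma Ck_comp_bounded_linear:
  assumes L: "bounded_linear L"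
  shows "Ck k f \<Longrightarrow> Ck k (\<lambda>x. f (L x))"
proof (induction k arbitrary: f)
  case 0
  thus ?case using assms continuous_on_compose2[OF _ linear_continuous_on[OF L], of UNIV f UNIV]
    by simp
next
  case (Suc k)
  show ?case
  proof (rule Ck_SucI)
    show "((\<lambda>x. f (L x)) has_derivative (\<lambda>v. dir_deriv (L v) f (L x))) (at x)" for x
      using has_derivative_compose[OF bounded_linear_imp_has_derivative[OF L]
          Ck_Suc_has_derivative[OF Suc.prems]] .
    show "Ck k (\<lambda>x. dir_deriv (L v) f (L x))" for v
      using Suc by auto
  qed
qed

lemma Ck_ident: "Ck k (\<lambda>x. x)"
proof (cases k)
  case (Suc j)
  show ?thesis unfolding Suc by (rule Ck_SucI[where f'="\<lambda>x v. v"]) auto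
qed auto

lemma Ck_prod:
  fixes f :: "'i \<Rightarrow> 'a::euclidean_space \<Rightarrow> 'b::real_normed_field"
  assumes "finite I" "\<And>i. i \<in> I \<Longrightarrow> Ck k (f i)"
  shows "Ck k (\<lambda>x. \<Prod>i\<in>I. f i x)"
  using assms by (induction I rule: finite_induct) (auto intro: Ck_mult)

lemma Ck_inverse:
  fixes f :: "'a::euclidean_space \<Rightarrow> real"
  assumes "\<And>x. f x \<noteq> 0"
  shows "Ck k f \<Longrightarrow> Ck k (\<lambda>x. inverse (f x))"
proof (induction k)
  case 0
  thus ?case using assms by (auto intro!: continuous_on_inverse)
next
  case (Suc k)
  show ?case
  proof (rule Ck_SucI)
    show "((\<lambda>x. inverse (f x)) has_derivative
        (\<lambda>v. - (inverse (f x) * dir_deriv v f x * inverse (f x)))) (at x)" for x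
      using Suc.prems assms by (intro Deriv.has_derivative_inverse Ck_Suc_has_derivative)
    have "Ck k f" "Ck k (dir_deriv v f)" for v
      using Suc.prems Ck_SucD by auto
    hence "Ck k (\<lambda>x. (-1) * (inverse (f x) * dir_deriv v f x * inverse (f x)))" for v
      using Suc.IH by (intro Ck_mult Ck_const)
    thus "Ck k (\<lambda>x. - (inverse (f x) * dir_deriv v f x * inverse (f x)))" for v
      by simp
  qed
qed

lemma Ck_real_SucI:
  assumes "\<And>x::real. (f has_vector_derivative f' x) (at x)" "Ck k f'"
  shows "Ck (Suc k) f"
proof (rule Ck_SucI)
  show "(f has_derivative (\<lambda>v. v *\<^sub>R f' x)) (at x)" for x
    using assms(1) by (simp add: has_vector_derivative_def)
  show "Ck k (\<lambda>x. v *\<^sub>R f' x)" for v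
    using assms(2) by (intro Ck_scaleR Ck_const)
qed

lemma dir_deriv_real:
  fixes f :: "real \<Rightarrow> real"
  assumes "Ck (Suc k) f"
  shows "(f has_real_derivative dir_deriv 1 f x) (at x)"
proof -
  have d: "(f has_derivative (\<lambda>v. dir_deriv v f x)) (at x)"
    by (rule Ck_Suc_has_derivative[OF assms])
  have "dir_deriv v f x = dir_deriv 1 f x * v" for v
    using linear_cmul[OF has_derivative_linear[OF d], of v 1] by (simp add: mult.commute)
  hence "(\<lambda>v. dir_deriv v f x) = (*) (dir_deriv 1 f x)" by (intro ext)
  thus ?thesis using d by (simp only: has_field_derivative_def)
qed

lemma Ck_comp_real:
  fixes f :: "'a::euclidean_space \<Rightarrow> real" and g :: "real \<Rightarrow> real"
  shows "Ck k g \<Longrightarrow> Ck k f \<Longrightarrow> Ck k (\<lambda>x. g (f x))"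
proof (induction k arbitrary: g)
  case 0
  thus ?case by (auto intro: continuous_on_compose2[of UNIV g])
next
  case (Suc k)
  show ?case
  proof (rule Ck_SucI)
    show "((\<lambda>x. g (f x)) has_derivative (\<lambda>v. dir_deriv 1 g (f x) * dir_deriv v f x)) (at x)" for x
      using has_derivative_compose[OF Ck_Suc_has_derivative[OF Suc.prems(2)]]
        dir_deriv_real[OF Suc.prems(1), of "f x"] by (auto simp: has_field_derivative_def)
    show "Ck k (\<lambda>x. dir_deriv 1 g (f x) * dir_deriv v f x)" for v
      using Suc.prems Ck_SucD[OF Suc.prems(2)] Suc.IH[of "dir_deriv 1 g"]
      by (intro Ck_mult) auto
  qed
qed

text \<open>The derivative of the inverse is \<open>1 / f' \<circ> f\<^sup>-\<^sup>1\<close>, which is as regular as the inverse itself.\<close>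

lemma smooth_inverse:
  fixes f g :: "real \<Rightarrow> real"
  assumes f: "smooth f" and d: "\<And>x. (f has_real_derivative f' x) (at x)" and nz: "\<And>x. f' x \<noteq> 0"
    and gf: "\<And>x. g (f x) = x" and fg: "\<And>y. f (g y) = y"
  shows "smooth g"
proof -
  have cont: "isCont g y" for y
    using isCont_inverse_function[of 1 "g y" g f] gf fg DERIV_isCont[OF d] by simp
  have dg: "(g has_real_derivative inverse (f' (g y))) (at y)" for y
    by (rule DERIV_inverse_function[where f=f and a="y-1" and b="y+1"])
      (use d nz fg cont in auto)
  have f'_eq: "f' = dir_deriv 1 f"
    using DERIV_unique[OF d dir_deriv_real[of 0]] f by (auto simp: smooth_def simp del: Ck.simps)
  have "Ck k g" for k
  proof (induction k)
    case 0
    show ?case using cont by (simp add: continuous_at_imp_continuous_on)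
  next
    case (Suc k)
    have "Ck k (\<lambda>x. inverse (f' x))"
      using nz smooth_dir_deriv[OF f, of 1] unfolding f'_eq smooth_def by (intro Ck_inverse) auto
    hence "Ck k (\<lambda>y. inverse (f' (g y)))"
      using Suc by (rule Ck_comp_real)
    thus ?case
      using dg by (intro Ck_real_SucI) (auto simp: has_real_derivative_iff_has_vector_derivative)
  qed
  thus ?thesis by (simp add: smooth_def)
qed

section \<open>A cutoff and a diffeomorphism\<close>

text \<open>One term of the exponential series is at most the sum. The estimate serves twice:
  against the pole at 0 in \<open>exp_bump\<close>, and to compare Gaussians with powers of the
  Japanese bracket.\<close>

lemma power_le_exp:
  fixes x :: real
  assumes "x \<ge> 0"
  shows "x ^ n \<le> fact n * exp x"
proof -
  have "(\<Sum>i\<in>{n}. x ^ i / fact i) \<le> exp x"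
    using assms sum_le_suminf[OF summable_exp_generic[of x], of "{n}"]
    by (simp add: exp_def divide_inverse mult.commute)
  hence "x ^ n / fact n \<le> exp x" by simp
  hence "x ^ n \<le> exp x * fact n" by (subst (asm) pos_divide_le_eq) auto
  thus ?thesis by (simp only: mult.commute)
qed

text \<open>The powers of \<open>inverse x\<close> are carried along because the derivative of one
  member is a combination of the next two. The whole family can then be proved smooth by one
  induction.\<close>

definition exp_bump :: "nat \<Rightarrow> real \<Rightarrow> real" where
  "exp_bump n x = (if x > 0 then inverse x ^ n * exp (- inverse x) else 0)"

lemma exp_bump_le: "\<bar>exp_bump n x\<bar> \<le> fact (Suc n) * \<bar>x\<bar>"
proof (cases "x > 0")
  case True
  have "inverse x ^ n * inverse x \<le> fact (Suc n) * exp (inverse x)"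
    using True power_le_exp[of "inverse x" "Suc n"] by (simp add: mult.commute)
  hence "inverse x ^ n * exp (- inverse x) \<le> fact (Suc n) * x"
    using True by (simp add: field_simps exp_minus)
  thus ?thesis using True by (simp add: exp_bump_def)
next
  case False
  have "(0::real) \<le> fact (Suc n) * \<bar>x\<bar>" by (intro mult_nonneg_nonneg) simp_all
  thus ?thesis using False by (simp add: exp_bump_def del: fact_Suc)
qed

lemma exp_bump_has_derivative:
  "(exp_bump n has_real_derivative exp_bump (n + 2) x - real n * exp_bump (n + 1) x) (at x)"
proof -
  consider "x > 0" | "x < 0" | "x = 0" by linarith
  thus ?thesis
  proof cases
    case 1
    have "((\<lambda>x. inverse x ^ n * exp (- inverse x)) has_real_derivative
        exp_bump (n + 2) x - real n * exp_bump (n + 1) x) (at x)"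
    proof -
      have inv: "(inverse has_real_derivative - (inverse x * inverse x)) (at x)"
        using 1 by (auto intro!: derivative_eq_intros simp: power2_eq_square)
      have "((\<lambda>x. inverse x ^ n) has_real_derivative - (real n * inverse x ^ (n + 1))) (at x)"
      proof (cases n)
        case (Suc j)
        show ?thesis unfolding Suc
          by (rule DERIV_cong[OF DERIV_power_Suc[OF inv]]) (simp add: algebra_simps)
      qed simp
      from DERIV_mult[OF this DERIV_fun_exp[OF DERIV_minus[OF inv]]] show ?thesis
        by (rule DERIV_cong) (use 1 in \<open>simp add: exp_bump_def algebra_simps\<close>)
    qed
    moreover have "\<forall>\<^sub>F y in nhds x. exp_bump n y = inverse y ^ n * exp (- inverse y)"
      using eventually_nhds_in_open[OF open_greaterThan[of 0], of x] 1
      by (auto elim!: eventually_mono simp: exp_bump_def)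
    ultimately show ?thesis
      by (subst DERIV_cong_ev[OF refl _ refl]) auto
  next
    case 2
    have "\<forall>\<^sub>F y in nhds x. exp_bump n y = 0"
      using eventually_nhds_in_open[OF open_lessThan[of 0], of x] 2
      by (auto elim!: eventually_mono simp: exp_bump_def)
    hence "(exp_bump n has_real_derivative 0) (at x)"
      by (subst DERIV_cong_ev[OF refl _ refl, where g="\<lambda>_. 0"]) auto
    thus ?thesis using 2 by (simp add: exp_bump_def)
  next
    case 3
    \<comment> \<open>At the origin the difference quotient of \<open>exp_bump n\<close> is exactly
      \<open>exp_bump (n + 1)\<close>, so its limit 0 there is the derivative.\<close>
    have "(exp_bump (n + 1) \<longlongrightarrow> 0) (at 0)"
    proof (rule tendsto_0_le[where K=1])
      show "((\<lambda>x. fact (Suc (n + 1)) * \<bar>x\<bar>) \<longlongrightarrow> (0::real)) (at 0)"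
        by (auto intro!: tendsto_eq_intros)
      show "\<forall>\<^sub>F x in at 0. norm (exp_bump (n + 1) x) \<le> norm (fact (Suc (n + 1)) * \<bar>x\<bar> :: real) * 1"
        using exp_bump_le[of "n + 1"] by (simp add: abs_mult)
    qed
    moreover have "(exp_bump n (0 + h) - exp_bump n 0) / h = exp_bump (n + 1) h" for h
      by (simp add: exp_bump_def field_simps)
    ultimately have "(exp_bump n has_real_derivative 0) (at 0)"
      unfolding DERIV_def by simp
    thus ?thesis using 3 by (simp add: exp_bump_def)
  qed
qed

lemma smooth_exp_bump: "smooth (exp_bump n)"
proof -
  have "Ck k (exp_bump n)" for k
  proof (induction k arbitrary: n)
    case 0
    show ?case using exp_bump_has_derivative
      by (auto simp: continuous_on_eq_continuous_at intro: DERIV_isCont)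
  next
    case (Suc k)
    have "Ck k (\<lambda>x. exp_bump (n + 2) x + (- real n) * exp_bump (n + 1) x)"
      by (intro Ck_add Ck_mult Ck_const Suc)
    thus ?case using exp_bump_has_derivative[of n]
      by (intro Ck_real_SucI[where f'="\<lambda>x. exp_bump (n + 2) x + (- real n) * exp_bump (n + 1) x"])
        (auto simp: has_real_derivative_iff_has_vector_derivative)
  qed
  thus ?thesis by (simp add: smooth_def)
qed

text \<open>The usual quotient for a smooth cutoff: the numerator vanishes once s^2 reaches 1, the
  other summand of the denominator vanishes up to s^2 = 1/4. These ranges are disjoint, so the
  denominator never vanishes. Squares keep the arguments polynomial in s.\<close>

definition plateau :: "real \<Rightarrow> real" where
  "plateau s = exp_bump 0 (1 - s\<^sup>2) * inverse (exp_bump 0 (1 - s\<^sup>2) + exp_bump 0 (s\<^sup>2 - 1/4))"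

lemma exp_bump_0_nonneg: "0 \<le> exp_bump 0 x"
  by (simp add: exp_bump_def)

lemma plateau_denom_pos: "0 < exp_bump 0 (1 - s\<^sup>2) + exp_bump 0 (s\<^sup>2 - 1/4)"
proof (cases "s\<^sup>2 < 1")
  case True
  hence "exp_bump 0 (1 - s\<^sup>2) > 0" by (simp add: exp_bump_def)
  thus ?thesis using exp_bump_0_nonneg[of "s\<^sup>2 - 1/4"] by linarith
next
  case False
  hence "exp_bump 0 (s\<^sup>2 - 1/4) > 0" by (simp add: exp_bump_def)
  thus ?thesis using exp_bump_0_nonneg[of "1 - s\<^sup>2"] by linarith
qed

lemma smooth_plateau: "smooth plateau"
proof -
  have "Ck k plateau" for k
  proof -
    have exp_bump: "Ck k (exp_bump 0)" using smooth_exp_bump by (simp add: smooth_def)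
    have "Ck k (\<lambda>s::real. 1 + (-1) * (s * s))" "Ck k (\<lambda>s::real. s * s + (- 1/4))"
      by (intro Ck_add Ck_mult Ck_const Ck_ident)+
    hence "Ck k (\<lambda>s::real. exp_bump 0 (1 - s\<^sup>2))" "Ck k (\<lambda>s. exp_bump 0 (s\<^sup>2 - 1/4))"
      using Ck_comp_real[OF exp_bump] by (simp_all add: power2_eq_square)
    thus ?thesis unfolding plateau_def[abs_def]
      using plateau_denom_pos by (intro Ck_mult Ck_inverse Ck_add) (auto simp: less_le)
  qed
  thus ?thesis by (simp add: smooth_def)
qed

lemma plateau_nonneg: "0 \<le> plateau s"
  unfolding plateau_def using plateau_denom_pos[of s] exp_bump_0_nonneg
  by (intro mult_nonneg_nonneg) auto

lemma plateau_le_1: "plateau s \<le> 1"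
  unfolding plateau_def using plateau_denom_pos[of s] exp_bump_0_nonneg[of "s\<^sup>2 - 1/4"]
  by (simp add: field_simps)

lemma plateau_eq_1: "\<bar>s\<bar> \<le> 1/2 \<Longrightarrow> plateau s = 1"
proof -
  assume "\<bar>s\<bar> \<le> 1/2"
  hence "s\<^sup>2 \<le> 1/4"
    using power_mono[of "\<bar>s\<bar>" "1/2" 2] by (simp add: power2_eq_square)
  thus ?thesis using plateau_denom_pos[of s] by (simp add: plateau_def exp_bump_def)
qed

lemma plateau_eq_0: "\<bar>s\<bar> \<ge> 1 \<Longrightarrow> plateau s = 0"
proof -
  assume "\<bar>s\<bar> \<ge> 1"
  hence "s\<^sup>2 \<ge> 1"
    using power_mono[of 1 "\<bar>s\<bar>" 2] by simp
  thus ?thesis by (simp add: plateau_def exp_bump_def)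
qed

text \<open>The identity is perturbed by a small multiple of t^2 times the cutoff. The perturbation
  has compact support, so its derivative is bounded, and a small enough multiple keeps the
  derivative of the sum positive.\<close>

lemma exists_diffeo_quadratic_near_0:
  obtains \<phi> :: "real \<Rightarrow> real" and a :: real
  where "smooth_diffeo \<phi>" "\<And>t. \<bar>t\<bar> \<ge> 1 \<Longrightarrow> \<phi> t = t" "a > 0"
    "\<And>t. \<bar>t\<bar> \<le> 1/2 \<Longrightarrow> \<phi> t = t + a * t\<^sup>2"
proof -
  define q where "q t = t * t * plateau t" for t
  have q: "smooth q" unfolding smooth_def q_def[abs_def]
    using smooth_plateau by (intro allI Ck_mult Ck_ident) (simp add: smooth_def)
  have dq: "(q has_real_derivative dir_deriv 1 q t) (at t)" for t
    using q by (intro dir_deriv_real[of 0]) (auto simp: smooth_def simp del: Ck.simps)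
  have q0: "q t = 0" if "\<bar>t\<bar> \<ge> 1" for t
    using plateau_eq_0[OF that] by (simp add: q_def)
  have "compact (dir_deriv 1 q ` {-1..1})"
    using smooth_continuous_on[OF smooth_dir_deriv[OF q]] by (intro compact_continuous_image) auto
  then obtain B where B: "B > 0" "\<And>t. \<bar>t\<bar> \<le> 1 \<Longrightarrow> \<bar>dir_deriv 1 q t\<bar> \<le> B"
    using compact_imp_bounded[of "dir_deriv 1 q ` {-1..1}"] unfolding bounded_pos
    by (auto simp: abs_le_iff)
  \<comment> \<open>This choice makes the derivative of a q at most 1/2 in absolute value.\<close>
  define a where "a = 1 / (2 * B)"
  define \<phi> where "\<phi> t = t + a * q t" for t
  have a: "a > 0" using B by (simp add: a_def)
  have \<phi>: "smooth \<phi>" unfolding smooth_def \<phi>_def[abs_def]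
    using q by (intro allI Ck_add Ck_mult Ck_ident Ck_const) (simp add: smooth_def)
  have d\<phi>: "(\<phi> has_real_derivative 1 + a * dir_deriv 1 q t) (at t)" for t
    unfolding \<phi>_def[abs_def] by (auto intro!: derivative_eq_intros dq)
  have \<phi>1: "\<phi> t = t" if "\<bar>t\<bar> \<ge> 1" for t using q0[OF that] by (simp add: \<phi>_def)
  have pos: "1 + a * dir_deriv 1 q t > 0" if "\<bar>t\<bar> \<le> 1" for t
  proof -
    have "\<bar>a * dir_deriv 1 q t\<bar> \<le> a * B"
      using B(2)[OF that] a by (simp add: abs_mult)
    also have "\<dots> = 1/2" using B by (simp add: a_def)
    finally show ?thesis by linarith
  qed
  have dq0: "dir_deriv 1 q t = 0" if t: "\<bar>t\<bar> > 1" for t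
  proof -
    have "open {t::real. \<bar>t\<bar> > 1}"
      by (intro open_Collect_less continuous_intros)
    hence "\<forall>\<^sub>F y in nhds t. q y = 0"
      using eventually_nhds_in_open[of "{t. \<bar>t\<bar> > 1}" t] t q0 by (auto elim!: eventually_mono)
    hence "(q has_real_derivative 0) (at t)"
      by (subst DERIV_cong_ev[OF refl _ refl, where g="\<lambda>_. 0"]) auto
    thus ?thesis using DERIV_unique dq by blast
  qed
  have pos': "1 + a * dir_deriv 1 q t > 0" for t
    using pos[of t] dq0[of t] by fastforce
  have mono: "strict_mono \<phi>"
  proof (rule strict_monoI)
    fix x y :: real assume "x < y"
    show "\<phi> x < \<phi> y"
      using DERIV_pos_imp_increasing[OF \<open>x < y\<close>, of \<phi>] d\<phi> pos' by blast
  qed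
  have "\<exists>x. \<phi> x = y" for y
  proof -
    \<comment> \<open>Both endpoints of [-?b, ?b] are fixed by \<open>\<phi>\<close>, so the
      intermediate value theorem reaches y.\<close>
    let ?b = "\<bar>y\<bar> + 1"
    have "\<exists>x. - ?b \<le> x \<and> x \<le> ?b \<and> \<phi> x = y"
      using \<phi>1[of "- ?b"] \<phi>1[of ?b]
      by (intro IVT' smooth_continuous_on[OF \<phi>]) auto
    thus "\<exists>x. \<phi> x = y" by blast
  qed
  hence "surj \<phi>" by (metis surjI)
  hence bij: "bij \<phi>" using strict_mono_imp_inj_on[OF mono] by (simp add: bij_def)
  have "smooth (inv \<phi>)"
    using pos' bij by (intro smooth_inverse[OF \<phi> d\<phi>])
      (auto simp: less_le bij_is_inj bij_is_surj surj_f_inv_f)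
  hence "smooth_diffeo \<phi>" using bij \<phi> by (simp add: smooth_diffeo_def)
  moreover have "\<phi> t = t + a * t\<^sup>2" if "\<bar>t\<bar> \<le> 1/2" for t
    using plateau_eq_1[OF that] by (simp add: \<phi>_def q_def power2_eq_square)
  ultimately show ?thesis using that \<phi>1 a by blast
qed

section \<open>Symbols and Schwartz functions\<close>

lemma jbracket_ge_1: "1 \<le> jbracket x"
  by (simp add: jbracket_def)

lemma jbracket_pos: "0 < jbracket x"
  using jbracket_ge_1[of x] by linarith

lemma norm_le_jbracket: "norm x \<le> jbracket x"
  unfolding jbracket_def by (rule real_le_rsqrt) simp

lemma jbracket_power2: "(jbracket x)\<^sup>2 = 1 + (norm x)\<^sup>2"
  by (simp add: jbracket_def)

lemma jbracket_powr_has_derivative: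
  fixes x :: "'a::euclidean_space"
  shows "((\<lambda>x. jbracket x powr s) has_derivative
    (\<lambda>v. s * (x \<bullet> v) * jbracket x powr (s - 2))) (at x)"
proof -
  have eq: "jbracket y powr s = (1 + y \<bullet> y) powr (s / 2)" for s and y :: 'a
    by (simp add: jbracket_def power2_norm_eq_inner powr_half_sqrt[symmetric] powr_powr)
  have pos: "1 + y \<bullet> y > 0" for y :: 'a
    by (simp add: add_pos_nonneg)
  have d: "((\<lambda>t. t powr (s / 2)) has_derivative (*) (s / 2 * (1 + x \<bullet> x) powr (s / 2 - 1)))
      (at (1 + x \<bullet> x))"
    using has_real_derivative_powr[OF pos[of x], of "s / 2"] by (simp add: has_field_derivative_def)
  have i: "((\<lambda>y. 1 + y \<bullet> y) has_derivative (\<lambda>v. 2 * (x \<bullet> v))) (at x)"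
    by (auto intro!: derivative_eq_intros simp: inner_commute)
  have "s / 2 - 1 = (s - 2) / 2" by (simp add: field_simps)
  with has_derivative_compose[OF i d] show ?thesis
    by (simp add: eq mult_ac)
qed

text \<open>For a family \<open>b\<close> in which the derivative of \<open>b s\<close> is a linear form times \<open>b (s - 2)\<close>, the
  functions of order \<open>s\<close> below are closed under differentiation, which lowers \<open>s\<close> by 1. This covers
  the powers of the Japanese bracket and, with a constant family, the Gaussians.\<close>

inductive graded :: "(real \<Rightarrow> 'a::euclidean_space \<Rightarrow> complex) \<Rightarrow> 'a \<Rightarrow> real \<Rightarrow> ('a \<Rightarrow> complex) \<Rightarrow> bool"
  for b :: "real \<Rightarrow> 'a::euclidean_space \<Rightarrow> complex" and \<mu> :: 'a where
  base: "graded b \<mu> s (b s)"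
| coord: "graded b \<mu> s f \<Longrightarrow> graded b \<mu> (s + 1) (\<lambda>x. of_real ((x - \<mu>) \<bullet> w) * f x)"
| add: "graded b \<mu> s f \<Longrightarrow> graded b \<mu> s g \<Longrightarrow> graded b \<mu> s (\<lambda>x. f x + g x)"
| scale: "graded b \<mu> s f \<Longrightarrow> graded b \<mu> s (\<lambda>x. c * f x)"

context
  fixes b :: "real \<Rightarrow> 'a::euclidean_space \<Rightarrow> complex" and \<mu> :: 'a and k :: "real \<Rightarrow> complex"
  assumes b_deriv: "\<And>s x. (b s has_derivative
    (\<lambda>v. k s * (of_real ((x - \<mu>) \<bullet> v) * b (s - 2) x))) (at x)"
begin

text \<open>Differentiating a coordinate factor removes it, and differentiating b s yields a
  coordinate factor (order +1) times b (s - 2); either way the order drops by 1. Differentiability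
  is proved in the same induction because each case needs it for its components.\<close>

lemma graded_deriv:
  "graded b \<mu> s f \<Longrightarrow>
    (\<forall>x. (f has_derivative (\<lambda>v. dir_deriv v f x)) (at x)) \<and> (\<forall>v. graded b \<mu> (s - 1) (dir_deriv v f))"
proof (induction rule: graded.induct)
  case (base s)
  have eq: "dir_deriv v (b s) = (\<lambda>x. k s * (of_real ((x - \<mu>) \<bullet> v) * b (s - 2) x))" for v
    by (rule dir_deriv_eq[OF b_deriv])
  have "graded b \<mu> (s - 2 + 1) (\<lambda>x. k s * (of_real ((x - \<mu>) \<bullet> v) * b (s - 2) x))" for v
    by (intro graded.intros)
  thus ?case using b_deriv[of s] by (simp add: eq)
next
  case (coord s f w)
  have d: "((\<lambda>x. complex_of_real ((x - \<mu>) \<bullet> w) * f x) has_derivative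
      (\<lambda>v. of_real ((x - \<mu>) \<bullet> w) * dir_deriv v f x + of_real (v \<bullet> w) * f x)) (at x)" for x
    using coord.IH by (auto intro!: derivative_eq_intros)
  have eq: "dir_deriv v (\<lambda>x. complex_of_real ((x - \<mu>) \<bullet> w) * f x) =
      (\<lambda>x. of_real ((x - \<mu>) \<bullet> w) * dir_deriv v f x + of_real (v \<bullet> w) * f x)" for v
    by (rule dir_deriv_eq[OF d])
  have "graded b \<mu> (s - 1 + 1)
      (\<lambda>x. of_real ((x - \<mu>) \<bullet> w) * dir_deriv v f x + of_real (v \<bullet> w) * f x)" for v
    using coord by (intro graded.add graded.coord graded.scale) auto
  thus ?case using d by (simp add: eq)
next
  case (add s f g)
  have d: "((\<lambda>x. f x + g x) has_derivative (\<lambda>v. dir_deriv v f x + dir_deriv v g x)) (at x)" for x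
    using add.IH by (intro has_derivative_add) auto
  have eq: "dir_deriv v (\<lambda>x. f x + g x) = (\<lambda>x. dir_deriv v f x + dir_deriv v g x)" for v
    by (rule dir_deriv_eq[OF d])
  show ?case using d add.IH by (auto simp: eq intro: graded.add)
next
  case (scale s f c)
  have d: "((\<lambda>x. c * f x) has_derivative (\<lambda>v. c * dir_deriv v f x)) (at x)" for x
    using scale.IH by (intro has_derivative_mult_right) auto
  have eq: "dir_deriv v (\<lambda>x. c * f x) = (\<lambda>x. c * dir_deriv v f x)" for v
    by (rule dir_deriv_eq[OF d])
  show ?case using d scale.IH by (auto simp: eq intro: graded.scale)
qed

lemma smooth_graded: "graded b \<mu> s f \<Longrightarrow> smooth f"
proof -
  have "graded b \<mu> s f \<Longrightarrow> Ck n f" for n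
  proof (induction n arbitrary: s f)
    case 0
    thus ?case using graded_deriv[OF 0]
      by (auto intro!: continuous_at_imp_continuous_on has_derivative_continuous)
  next
    case (Suc n)
    thus ?case using graded_deriv[OF Suc.prems] by (intro Ck_SucI) auto
  qed
  thus "graded b \<mu> s f \<Longrightarrow> smooth f" by (simp add: smooth_def)
qed

lemma graded_iter_deriv: "graded b \<mu> s f \<Longrightarrow> graded b \<mu> (s - real (length vs)) (iter_deriv vs f)"
proof (induction vs)
  case (Cons v vs)
  have "graded b \<mu> (s - real (length vs) - 1) (dir_deriv v (iter_deriv vs f))"
    using graded_deriv Cons by blast
  moreover have "s - real (length vs) - 1 = s - real (length (v # vs))" by simp
  ultimately show ?case by (simp only: iter_deriv_def foldr.simps o_apply)
qed (simp add: iter_deriv_def)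

text \<open>A coordinate factor costs one power of the bracket, since |x - \<open>\<mu>\<close>| is
  at most (1 + |\<open>\<mu>\<close>|) times the bracket of x. Hence bounds for the family b pass to
  everything generated from it.\<close>

lemma graded_bound:
  assumes "\<And>s. \<exists>C. \<forall>x. cmod (b s x) \<le> C * jbracket x powr s"
  shows "graded b \<mu> s f \<Longrightarrow> \<exists>C. \<forall>x. cmod (f x) \<le> C * jbracket x powr s"
proof (induction rule: graded.induct)
  case (base s)
  show ?case by (rule assms)
next
  case (coord s f w)
  then obtain C where C: "\<And>x. cmod (f x) \<le> C * jbracket x powr s" by blast
  have "cmod (of_real ((x - \<mu>) \<bullet> w) * f x) \<le> ((1 + norm \<mu>) * norm w * C) * jbracket x powr (s + 1)" for x
  proof -
    have "norm (x - \<mu>) \<le> norm x + norm \<mu>" by (rule norm_triangle_ineq4)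
    also have "\<dots> \<le> jbracket x * 1 + jbracket x * norm \<mu>"
      using norm_le_jbracket[of x] mult_right_mono[OF jbracket_ge_1[of x] norm_ge_zero[of \<mu>]] by simp
    finally have "norm (x - \<mu>) \<le> (1 + norm \<mu>) * jbracket x" by (simp add: algebra_simps)
    hence "norm (x - \<mu>) * norm w \<le> (1 + norm \<mu>) * jbracket x * norm w"
      by (rule mult_right_mono) simp
    hence "\<bar>(x - \<mu>) \<bullet> w\<bar> \<le> (1 + norm \<mu>) * jbracket x * norm w"
      using Cauchy_Schwarz_ineq2[of "x - \<mu>" w] by linarith
    hence "\<bar>(x - \<mu>) \<bullet> w\<bar> * cmod (f x) \<le> ((1 + norm \<mu>) * jbracket x * norm w) * (C * jbracket x powr s)"
      using C[of x] jbracket_pos[of x] by (intro mult_mono) auto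
    also have "\<dots> = ((1 + norm \<mu>) * norm w * C) * jbracket x powr (s + 1)"
      using jbracket_pos[of x] by (simp add: powr_add)
    finally show ?thesis by (simp add: norm_mult del: of_real_inner_1)
  qed
  thus ?case by blast
next
  case (add s f g)
  then obtain C D where "\<And>x. cmod (f x) \<le> C * jbracket x powr s" "\<And>x. cmod (g x) \<le> D * jbracket x powr s"
    by blast
  hence "cmod (f x + g x) \<le> (C + D) * jbracket x powr s" for x
    by (smt (verit) norm_triangle_ineq distrib_right)
  thus ?case by blast
next
  case (scale s f c)
  then obtain C where "\<And>x. cmod (f x) \<le> C * jbracket x powr s" by blast
  hence "cmod (c * f x) \<le> (cmod c * C) * jbracket x powr s" for x
    by (simp add: norm_mult mult.assoc mult_left_mono)
  thus ?case by blast
qed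

end

definition bracket_power :: "real \<Rightarrow> 'a::euclidean_space \<Rightarrow> complex" where
  "bracket_power s x = of_real (jbracket x powr s)"

lemma bracket_power_deriv:
  "(bracket_power s has_derivative
    (\<lambda>v. of_real s * (of_real ((x - 0) \<bullet> v) * bracket_power (s - 2) x))) (at x)"
  using has_derivative_of_real[OF jbracket_powr_has_derivative[of s x], where 'a=complex]
  by (simp add: bracket_power_def[abs_def] mult.assoc)

lemma smooth_bracket_power: "smooth (bracket_power s)"
  by (rule smooth_graded[where b=bracket_power and \<mu>=0 and k=of_real, OF bracket_power_deriv])
    (rule graded.base)

lemma bracket_power_iter_deriv_bound:
  "\<exists>C. \<forall>x. cmod (iter_deriv vs (bracket_power m) x) \<le> C * jbracket x powr (m - real (length vs))"
proof (rule graded_bound[where b=bracket_power and \<mu>=0 and k=of_real, OF bracket_power_deriv])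
  show "\<exists>C. \<forall>x. cmod (bracket_power s x) \<le> C * jbracket x powr s" for s
    by (intro exI[of _ 1]) (simp add: bracket_power_def)
  show "graded bracket_power 0 (m - real (length vs)) (iter_deriv vs (bracket_power m))"
    by (rule graded_iter_deriv[where b=bracket_power and \<mu>=0 and k=of_real, OF bracket_power_deriv])
      (rule graded.base)
qed

section \<open>Gaussians as Schwartz functions\<close>

definition gauss :: "complex \<Rightarrow> 'a::euclidean_space \<Rightarrow> 'a \<Rightarrow> complex" where
  "gauss c \<mu> x = exp (- c * of_real ((norm (x - \<mu>))\<^sup>2))"

lemma gauss_deriv:
  "(gauss c \<mu> has_derivative (\<lambda>v. - 2 * c * (of_real ((x - \<mu>) \<bullet> v) * gauss c \<mu> x))) (at x)"
proof -
  have "((\<lambda>x. - c * of_real ((norm (x - \<mu>))\<^sup>2)) has_derivative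
      (\<lambda>v. - c * of_real (2 * ((x - \<mu>) \<bullet> v)))) (at x)"
    unfolding power2_norm_eq_inner
    by (auto intro!: derivative_eq_intros simp: inner_commute algebra_simps)
  from has_derivative_compose[OF this DERIV_exp[unfolded has_field_derivative_def]] show ?thesis
    unfolding gauss_def[abs_def] by (simp add: mult_ac)
qed

lemma norm_gauss: "cmod (gauss c \<mu> x) = exp (- Re c * (norm (x - \<mu>))\<^sup>2)"
  by (simp add: gauss_def)

text \<open>Since |x|^2 is at most 2|x - \<open>\<mu>\<close>|^2 + 2|\<open>\<mu>\<close>|^2, decay
  around \<open>\<mu>\<close> gives decay in the bracket at half the rate, and the exponential beats
  every power. As s is arbitrary, the constant family of Gaussians satisfies the hypothesis of
  \<open>graded_bound\<close>.\<close>

lemma gauss_bound: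
  assumes c: "Re c > 0"
  shows "\<exists>C. \<forall>x. cmod (gauss c \<mu> x) \<le> C * jbracket x powr s"
proof -
  \<comment> \<open>N is large enough that the bracket to the power -2N is at most its power
    s.\<close>
  define N where "N = nat \<lceil>\<bar>s\<bar>\<rceil>"
  have N: "- s \<le> 2 * real N" unfolding N_def by linarith
  define r where "r = Re c / 2"
  have r: "r > 0" using c by (simp add: r_def)
  define A where "A = 1 + 2 * (norm \<mu>)\<^sup>2"
  define C where "C = fact N / r ^ N * exp (r * A)"
  have "cmod (gauss c \<mu> x) \<le> C * jbracket x powr s" for x
  proof -
    define y where "y = (jbracket x)\<^sup>2"
    have y: "y > 0" using jbracket_pos[of x] by (simp add: y_def)
    have "(norm x)\<^sup>2 \<le> (norm (x - \<mu>) + norm \<mu>)\<^sup>2"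
      using norm_triangle_ineq[of "x - \<mu>" \<mu>] by (intro power_mono) auto
    also have "\<dots> \<le> 2 * (norm (x - \<mu>))\<^sup>2 + 2 * (norm \<mu>)\<^sup>2"
      using sum_squares_bound[of "norm (x - \<mu>)" "norm \<mu>"] by (simp add: power2_sum)
    finally have yA: "y - A \<le> 2 * (norm (x - \<mu>))\<^sup>2"
      by (simp add: y_def A_def jbracket_power2)
    have "r * (y - A) \<le> r * (2 * (norm (x - \<mu>))\<^sup>2)"
      using yA r by (intro mult_left_mono) auto
    hence "cmod (gauss c \<mu> x) \<le> exp (r * A - r * y)"
      by (simp add: norm_gauss r_def algebra_simps)
    also have "\<dots> = exp (r * A) / exp (r * y)" by (simp add: exp_diff)
    also have "\<dots> \<le> exp (r * A) / ((r * y) ^ N / fact N)"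
      using power_le_exp[of "r * y" N] r y
      by (intro divide_left_mono) (auto simp: field_simps)
    also have "\<dots> = C * inverse (y ^ N)"
      using r y by (simp add: C_def power_mult_distrib field_simps)
    also have "\<dots> = C * jbracket x powr (- (2 * real N))"
      using powr_realpow[OF jbracket_pos[of x], of "2 * N"]
      by (simp add: y_def powr_minus power_mult)
    also have "\<dots> \<le> C * jbracket x powr s"
      using N r jbracket_ge_1[of x] by (intro mult_left_mono powr_mono) (auto simp: C_def)
    finally show ?thesis .
  qed
  thus ?thesis by blast
qed

lemma gauss_schwartz:
  assumes c: "Re c > 0"
  shows "gauss c (\<mu> :: real^'n) \<in> schwartz"
proof -
  note g = gauss_deriv[of c \<mu>]
  have gr: "graded (\<lambda>s. gauss c \<mu>) \<mu> s (gauss c \<mu>)" for s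
    using graded.base[of "\<lambda>s. gauss c \<mu>"] .
  have "smooth (gauss c \<mu>)"
    using smooth_graded[of "\<lambda>s. gauss c \<mu>" "\<lambda>_. - 2 * c" \<mu>, OF g gr[of 0]] .
  moreover have "\<exists>C. \<forall>x. jbracket x ^ N * cmod (partial \<alpha> (gauss c \<mu>) x) \<le> C" for N :: nat and \<alpha>
  proof -
    let ?vs = "map (\<lambda>i. axis i 1) \<alpha> :: (real^'n) list"
    \<comment> \<open>For a constant family the initial order is free; it is taken so that order -N
      remains after the derivatives.\<close>
    have "graded (\<lambda>s. gauss c \<mu>) \<mu> (real (length ?vs) - real N - real (length ?vs)) (iter_deriv ?vs (gauss c \<mu>))"
      by (rule graded_iter_deriv[of "\<lambda>s. gauss c \<mu>" "\<lambda>_. - 2 * c" \<mu>, OF g gr])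
    from graded_bound[of "\<lambda>s. gauss c \<mu>" "\<lambda>_. - 2 * c" \<mu>, OF g gauss_bound[OF c] this]
    obtain C where C: "\<And>x. cmod (partial \<alpha> (gauss c \<mu>) x) \<le> C * jbracket x powr (- real N)"
      by (auto simp: partial_def)
    have "jbracket x ^ N * cmod (partial \<alpha> (gauss c \<mu>) x) \<le> C" for x
    proof -
      have "jbracket x ^ N * cmod (partial \<alpha> (gauss c \<mu>) x) \<le> jbracket x ^ N * (C * jbracket x powr (- real N))"
        using C jbracket_pos[of x] by (intro mult_left_mono) auto
      also have "\<dots> = C" using jbracket_pos[of x] by (simp add: powr_minus powr_realpow)
      finally show ?thesis .
    qed
    thus ?thesis by blast
  qed
  ultimately show ?thesis by (simp add: schwartz_def)
qed

section \<open>Symbols that are products of a function of x and a function of \<eta>\<close>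

lemma smooth_iter_deriv: "smooth f \<Longrightarrow> smooth (iter_deriv vs f)"
  by (induction vs) (auto simp: iter_deriv_def smooth_dir_deriv)

lemma dir_deriv_zero: "smooth f \<Longrightarrow> dir_deriv 0 f x = 0"
  using smooth_has_derivative[of f x] has_derivative_linear linear_0 by fastforce

lemma dir_deriv_tensor:
  fixes f :: "'a::euclidean_space \<Rightarrow> complex" and g :: "'b::euclidean_space \<Rightarrow> complex"
  assumes "smooth f" "smooth g"
  shows "dir_deriv (v, w) (\<lambda>p. f (fst p) * g (snd p)) =
    (\<lambda>p. f (fst p) * dir_deriv w g (snd p) + dir_deriv v f (fst p) * g (snd p))"
proof -
  have "((\<lambda>p. f (fst p) * g (snd p)) has_derivative
      (\<lambda>h. f (fst p) * dir_deriv (snd h) g (snd p) + dir_deriv (fst h) f (fst p) * g (snd p))) (at p)" for p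
    by (intro has_derivative_mult has_derivative_compose[OF bounded_linear_imp_has_derivative[OF bounded_linear_fst]]
        has_derivative_compose[OF bounded_linear_imp_has_derivative[OF bounded_linear_snd]] smooth_has_derivative assms)
  from dir_deriv_eq[OF this, of "(v, w)"] show ?thesis by simp
qed

lemma iter_deriv_tensor_fst:
  fixes f :: "'a::euclidean_space \<Rightarrow> complex" and g :: "'b::euclidean_space \<Rightarrow> complex"
  assumes "smooth f" "smooth g"
  shows "iter_deriv (map (\<lambda>i. (h i, 0)) is) (\<lambda>p. f (fst p) * g (snd p)) =
    (\<lambda>p. iter_deriv (map h is) f (fst p) * g (snd p))"
proof (induction "is")
  case (Cons i "is")
  have "smooth (iter_deriv (map h is) f)" using assms(1) by (rule smooth_iter_deriv)
  from dir_deriv_tensor[OF this assms(2), of "h i" 0] Cons dir_deriv_zero[OF assms(2)]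
  show ?case by (simp add: iter_deriv_def)
qed (simp add: iter_deriv_def)

lemma iter_deriv_tensor_snd:
  fixes f :: "'a::euclidean_space \<Rightarrow> complex" and g :: "'b::euclidean_space \<Rightarrow> complex"
  assumes "smooth f" "smooth g"
  shows "iter_deriv (map (\<lambda>i. (0, h i)) is) (\<lambda>p. f (fst p) * g (snd p)) =
    (\<lambda>p. f (fst p) * iter_deriv (map h is) g (snd p))"
proof (induction "is")
  case (Cons i "is")
  have "smooth (iter_deriv (map h is) g)" using assms(2) by (rule smooth_iter_deriv)
  from dir_deriv_tensor[OF assms(1) this, of 0 "h i"] Cons dir_deriv_zero[OF assms(1)]
  show ?case by (simp add: iter_deriv_def)
qed (simp add: iter_deriv_def)

text \<open>The strict inequality makes the region open, so vanishing on it passes to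
  derivatives.\<close>

lemma iter_deriv_eq_0_outside:
  assumes "\<And>\<eta>. norm \<eta> > R \<Longrightarrow> g \<eta> = 0" "norm \<eta> > R"
  shows "iter_deriv vs g \<eta> = 0"
  using assms(2)
proof (induction vs arbitrary: \<eta>)
  case (Cons v vs)
  have op: "open {\<eta>. norm \<eta> > R}"
    by (intro open_Collect_less continuous_intros)
  have "(iter_deriv vs g has_derivative (\<lambda>_. 0)) (at \<eta>)"
    by (rule has_derivative_transform_within_open[OF has_derivative_const[of 0] op]) (use Cons in auto)
  hence "frechet_derivative (iter_deriv vs g) (at \<eta>) = (\<lambda>_. 0)"
    by (rule frechet_derivative_at[symmetric])
  thus ?case by (simp add: iter_deriv_def dir_deriv_def)
qed (use assms in \<open>simp add: iter_deriv_def\<close>)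

text \<open>Continuity gives the bound on the closed ball, and outside it there is nothing to bound.
  That s is arbitrary is what later yields order minus infinity in \<eta>.\<close>

lemma compact_support_bound:
  fixes g :: "'a::euclidean_space \<Rightarrow> complex"
  assumes "continuous_on UNIV g" "\<And>\<eta>. norm \<eta> > R \<Longrightarrow> g \<eta> = 0"
  shows "\<exists>C\<ge>0. \<forall>\<eta>. cmod (g \<eta>) \<le> C * jbracket \<eta> powr s"
proof -
  have "continuous_on (cball 0 R) (\<lambda>\<eta>. cmod (g \<eta>) * jbracket \<eta> powr (- s))"
    unfolding jbracket_def using assms(1)
    by (auto intro!: continuous_intros continuous_on_subset[OF assms(1)] simp: add_nonneg_eq_0_iff)
  hence "bounded ((\<lambda>\<eta>. cmod (g \<eta>) * jbracket \<eta> powr (- s)) ` cball 0 R)"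
    by (intro compact_imp_bounded compact_continuous_image) auto
  then obtain B where B: "B > 0" "\<And>\<eta>. norm \<eta> \<le> R \<Longrightarrow> cmod (g \<eta>) * jbracket \<eta> powr (- s) \<le> B"
    unfolding bounded_pos by auto
  have "cmod (g \<eta>) \<le> B * jbracket \<eta> powr s" for \<eta>
  proof (cases "norm \<eta> \<le> R")
    case True
    thus ?thesis using B(2)[OF True] jbracket_pos[of \<eta>] by (simp add: powr_minus field_simps)
  next
    case False
    thus ?thesis using assms(2) B by simp
  qed
  thus ?thesis using B(1) by (intro exI[of _ B]) auto
qed

text \<open>Mixed derivatives factor. The x-factor is a derivative of a bracket power, which loses
  one order per derivative; the \<eta>-factor has compact support and so obeys the bound for every
  m1.\<close>

lemma tensor_in_SG_minus_inf:
  fixes g :: "real^'n \<Rightarrow> complex"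
  assumes g: "smooth g" "\<And>\<eta>. norm \<eta> > R \<Longrightarrow> g \<eta> = 0"
  shows "(\<lambda>(x, \<eta>). bracket_power m x * g \<eta>) \<in> SG_minus_inf m"
proof -
  let ?\<sigma> = "\<lambda>p :: (real^'n) \<times> (real^'n). bracket_power m (fst p) * g (snd p)"
  have w: "Ck k (\<lambda>p::(real^'n) \<times> (real^'n). bracket_power m (fst p))" for k
    using smooth_bracket_power[of m, where ?'a="real^'n"]
    by (intro Ck_comp_bounded_linear[OF bounded_linear_fst]) (simp add: smooth_def)
  have h: "Ck k (\<lambda>p::(real^'n) \<times> (real^'n). g (snd p))" for k
    using g(1) by (intro Ck_comp_bounded_linear[OF bounded_linear_snd]) (simp add: smooth_def)
  have "Ck k ?\<sigma>" for k
    by (rule Ck_mult[OF w h])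
  hence "smooth ?\<sigma>" by (simp add: smooth_def)
  moreover have "\<exists>C. \<forall>x \<eta>. cmod (partial_snd \<alpha> (partial_fst \<beta> ?\<sigma>) (x, \<eta>))
        \<le> C * jbracket \<eta> powr (m1 - real (length \<alpha>)) * jbracket x powr (m - real (length \<beta>))"
    for \<alpha> \<beta> and m1
  proof -
    let ?w = "iter_deriv (map (\<lambda>i. axis i 1) \<beta>) (bracket_power m) :: real^'n \<Rightarrow> complex"
    let ?h = "iter_deriv (map (\<lambda>i. axis i 1) \<alpha>) g :: real^'n \<Rightarrow> complex"
    have eq: "partial_snd \<alpha> (partial_fst \<beta> ?\<sigma>) = (\<lambda>p. ?w (fst p) * ?h (snd p))"
      unfolding partial_fst_def partial_snd_def
        iter_deriv_tensor_fst[where h="\<lambda>i. axis i 1", OF smooth_bracket_power g(1)]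
      by (rule iter_deriv_tensor_snd[OF smooth_iter_deriv[OF smooth_bracket_power] g(1)])
    obtain C1 where C1: "\<And>x::real^'n. cmod (?w x) \<le> C1 * jbracket x powr (m - real (length \<beta>))"
      using bracket_power_iter_deriv_bound[of "map (\<lambda>i. axis i 1) \<beta>" m] by auto
    obtain C2 where C2: "C2 \<ge> 0" "\<And>\<eta>. cmod (?h \<eta>) \<le> C2 * jbracket \<eta> powr (m1 - real (length \<alpha>))"
      using compact_support_bound[of ?h R] g smooth_continuous_on[OF smooth_iter_deriv[OF g(1)]]
        iter_deriv_eq_0_outside[of R g] by blast
    have "cmod (?w x * ?h \<eta>) \<le> (C1 * C2) * jbracket \<eta> powr (m1 - real (length \<alpha>))
        * jbracket x powr (m - real (length \<beta>))" for x \<eta>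
      using mult_mono[OF C1[of x] C2(2)[of \<eta>]] order_trans[OF norm_ge_zero C1[of x]]
      by (simp add: norm_mult mult_ac)
    thus ?thesis unfolding eq by (intro exI[of _ "C1 * C2"]) simp
  qed
  ultimately show ?thesis unfolding SG_minus_inf_def SG_def by (simp add: case_prod_beta')
qed

section \<open>Complex Gaussian integrals\<close>

text \<open>The integrand for the Fourier integral of a Gaussian of complex width: Re z gives the
  decay, Im z the quadratic phase, b the frequency.\<close>

definition chirp :: "complex \<Rightarrow> real \<Rightarrow> real \<Rightarrow> complex" where
  "chirp z b s = exp (of_real pi * (2 * \<i> * of_real (b * s) - z * of_real (s\<^sup>2)))"

lemma norm_chirp: "cmod (chirp z b s) = exp (- pi * Re z * s\<^sup>2)"
  by (simp add: chirp_def)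

lemma continuous_on_chirp [continuous_intros]:
  "continuous_on A (chirp z b)"
  unfolding chirp_def[abs_def] by (intro continuous_intros)

lemma borel_measurable_chirp [measurable]: "chirp z b \<in> borel_measurable borel"
  by (intro borel_measurable_continuous_onI continuous_on_chirp)

lemma gaussian_integral:
  assumes "r > 0"
  shows "integrable lborel (\<lambda>x. exp (- pi * r * (x - \<mu>)\<^sup>2))"
    and "(LINT x|lborel. exp (- pi * r * (x - \<mu>)\<^sup>2)) = 1 / sqrt r"
proof -
  define \<sigma> where "\<sigma> = 1 / sqrt (2 * pi * r)"
  have \<sigma>: "\<sigma> > 0" using assms by (simp add: \<sigma>_def)
  have \<sigma>2: "\<sigma>\<^sup>2 = 1 / (2 * pi * r)" using assms by (simp add: \<sigma>_def power_divide)
  have eq: "exp (- pi * r * (x - \<mu>)\<^sup>2) = 1 / sqrt r * normal_density \<mu> \<sigma> x" for x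
    using assms by (simp add: normal_density_def \<sigma>2 real_sqrt_divide field_simps)
  show "integrable lborel (\<lambda>x. exp (- pi * r * (x - \<mu>)\<^sup>2))"
    unfolding eq using \<sigma> by (intro integrable_mult_right) auto
  show "(LINT x|lborel. exp (- pi * r * (x - \<mu>)\<^sup>2)) = 1 / sqrt r"
    unfolding eq using \<sigma> by simp
qed

lemma integrable_chirp:
  assumes "Re z > 0"
  shows "integrable lborel (chirp z b)"
  by (rule Bochner_Integration.integrable_bound[OF gaussian_integral(1)[OF assms, of 0]])
    (auto simp: norm_chirp)

text \<open>A rescaling of the characteristic function of the standard normal distribution.\<close>

lemma integral_chirp_real:
  assumes r: "r > 0"
  shows "(LINT s|lborel. chirp (of_real r) b s) = of_real (exp (- pi * b\<^sup>2 / r) / sqrt r)"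
proof -
  \<comment> \<open>The substitution x = c s turns exp(-x^2/2) into exp(-\<pi> r s^2); t is then
    chosen so that t x = 2 \<pi> b s.\<close>
  define c where "c = sqrt (2 * pi * r)"
  have c: "c > 0" "c\<^sup>2 = 2 * pi * r" using r by (auto simp: c_def)
  define t where "t = 2 * pi * b / c"
  have "of_real (exp (- t\<^sup>2 / 2)) = (LINT x|std_normal_distribution. iexp (t * x))"
    using fun_cong[OF char_std_normal_distribution, of t] by (simp add: char_def)
  also have "\<dots> = (LINT x|lborel. std_normal_density x *\<^sub>R iexp (t * x))"
    by (subst integral_density) auto
  also have "\<dots> = c *\<^sub>R (LINT s|lborel. std_normal_density (c * s) *\<^sub>R iexp (t * (c * s)))"
    using c(1) by (subst lborel_integral_real_affine[where c=c and t=0]) auto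
  also have "(\<lambda>s. std_normal_density (c * s) *\<^sub>R iexp (t * (c * s))) =
      (\<lambda>s. of_real (1 / sqrt (2 * pi)) * chirp (of_real r) b s)"
  proof
    fix s
    have "- (c * s)\<^sup>2 / 2 = - pi * r * s\<^sup>2" using c(2) by (simp add: power_mult_distrib)
    moreover have "t * (c * s) = 2 * pi * b * s" using c(1) by (simp add: t_def)
    moreover have "chirp (of_real r) b s =
        exp (of_real (- pi * r * s\<^sup>2) + \<i> * of_real (2 * pi * b * s))"
      by (simp add: chirp_def algebra_simps)
    ultimately show "std_normal_density (c * s) *\<^sub>R iexp (t * (c * s)) =
        of_real (1 / sqrt (2 * pi)) * chirp (of_real r) b s"
      by (simp only: std_normal_density_def scaleR_conv_of_real exp_of_real[symmetric]
          exp_add of_real_mult mult.assoc)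
  qed
  finally have "of_real (exp (- t\<^sup>2 / 2)) =
      of_real (c / sqrt (2 * pi)) * (LINT s|lborel. chirp (of_real r) b s)"
    by (simp add: scaleR_conv_of_real)
  moreover have "c / sqrt (2 * pi) = sqrt r" by (simp add: c_def real_sqrt_mult)
  moreover have "- t\<^sup>2 / 2 = - pi * b\<^sup>2 / r"
    using r c by (simp add: t_def power_divide power_mult_distrib field_simps power2_eq_square)
  ultimately have "of_real (exp (- pi * b\<^sup>2 / r)) =
      of_real (sqrt r) * (LINT s|lborel. chirp (of_real r) b s)"
    by (simp only:)
  thus ?thesis using r by (simp add: field_simps)
qed

text \<open>Truncations to [-n, n] are holomorphic by differentiation under the integral sign. They
  converge locally uniformly because the tails have a Gaussian majorant that does not depend on
  z.\<close>

lemma integral_chirp_holomorphic: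
  "(\<lambda>z. LINT s|lborel. chirp z b s) holomorphic_on {z. Re z > 0}"
proof (rule holomorphic_uniform_sequence)
  let ?S = "{z. Re z > 0}"
  define F where "F n z = integral (cbox (- real n) (real n)) (chirp z b)" for n z
  show "open ?S" by (rule open_halfspace_Re_gt)
  show "F n holomorphic_on ?S" for n
    unfolding F_def
  proof (rule leibniz_rule_holomorphic)
    show "((\<lambda>z. chirp z b s) has_field_derivative - of_real pi * of_real (s\<^sup>2) * chirp z b s)
        (at z within ?S)" for z s
      unfolding chirp_def by (auto intro!: derivative_eq_intros)
    show "chirp z b integrable_on cbox (- real n) (real n)" for z
      by (intro integrable_continuous continuous_intros)
    show "continuous_on (?S \<times> cbox (- real n) (real n))
        (\<lambda>(z, s). - of_real pi * of_real (s\<^sup>2) * chirp z b s)"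
      unfolding chirp_def case_prod_beta' by (intro continuous_intros)
    show "convex ?S" by (rule convex_halfspace_Re_gt)
  qed
  fix w assume w: "w \<in> ?S"
  \<comment> \<open>On the closed ball of radius c around w the real part stays at least c, so
    exp(-\<pi> c s^2) dominates there, and its tails \<open>T n\<close> bound the error
    uniformly.\<close>
  define c where "c = Re w / 2"
  have c: "c > 0" using w by (simp add: c_def)
  have cb: "Re z \<ge> c" if "z \<in> cball w c" for z
    using that abs_Re_le_cmod[of "w - z"] by (simp add: dist_norm c_def)
  define T where "T n = (LINT s|lborel. indicator (- {- real n..real n}) s *\<^sub>R exp (- pi * c * s\<^sup>2))" for n
  note gi = gaussian_integral(1)[OF c, of 0, simplified]
  have "T \<longlonglongrightarrow> (LINT s::real|lborel. 0)"
    unfolding T_def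
  proof (rule integral_dominated_convergence[where w="\<lambda>s. exp (- pi * c * s\<^sup>2)"])
    show "AE s in lborel. (\<lambda>n. indicator (- {- real n..real n}) s *\<^sub>R exp (- pi * c * s\<^sup>2)) \<longlonglongrightarrow> 0"
    proof (intro AE_I2)
      fix s :: real
      have "\<forall>\<^sub>F n in sequentially. \<bar>s\<bar> \<le> real n"
        by real_asymp
      hence "\<forall>\<^sub>F n in sequentially. indicator (- {- real n..real n}) s *\<^sub>R exp (- pi * c * s\<^sup>2) = 0"
        by eventually_elim (auto simp: indicator_def abs_le_iff)
      thus "(\<lambda>n. indicator (- {- real n..real n}) s *\<^sub>R exp (- pi * c * s\<^sup>2)) \<longlonglongrightarrow> 0"
        by (rule tendsto_eventually)
    qed
  qed (use gi in \<open>auto simp: indicator_def\<close>)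
  hence T: "T \<longlonglongrightarrow> 0" by simp
  have dist: "dist (F n z) (LINT s|lborel. chirp z b s) \<le> T n" if z: "z \<in> cball w c" for n z
  proof -
    have Re: "Re z > 0" using cb[OF z] c by linarith
    note ic = integrable_chirp[OF Re, of b]
    have si: "set_integrable lborel {- real n..real n} (chirp z b)"
      unfolding set_integrable_def using ic by (intro integrable_mult_indicator) auto
    have "F n z = (LINT s|lborel. indicator {- real n..real n} s *\<^sub>R chirp z b s)"
      using set_borel_integral_eq_integral(2)[OF si] by (simp add: F_def set_lebesgue_integral_def)
    hence "(LINT s|lborel. chirp z b s) - F n z =
        (LINT s|lborel. chirp z b s - indicator {- real n..real n} s *\<^sub>R chirp z b s)"
      using si ic by (simp add: set_integrable_def)
    also have "\<dots> = (LINT s|lborel. indicator (- {- real n..real n}) s *\<^sub>R chirp z b s)"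
      by (intro Bochner_Integration.integral_cong) (auto simp: indicator_def)
    also have "cmod \<dots> \<le> T n"
      unfolding T_def
    proof (rule Bochner_Integration.integral_norm_bound_integral)
      show "integrable lborel (\<lambda>s. indicator (- {- real n..real n}) s *\<^sub>R chirp z b s)"
        using ic by (intro integrable_mult_indicator) auto
      show "integrable lborel (\<lambda>s. indicator (- {- real n..real n}) s *\<^sub>R exp (- pi * c * s\<^sup>2))"
        using gi by (intro integrable_mult_indicator) auto
      show "cmod (indicator (- {- real n..real n}) s *\<^sub>R chirp z b s) \<le>
          indicator (- {- real n..real n}) s *\<^sub>R exp (- pi * c * s\<^sup>2)" for s
        using cb[OF z] by (auto simp: norm_chirp indicator_def mult_right_mono)
    qed
    finally show ?thesis by (simp add: dist_norm norm_minus_commute)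
  qed
  show "\<exists>d. 0 < d \<and> cball w d \<subseteq> ?S \<and> uniform_limit (cball w d) F (\<lambda>z. LINT s|lborel. chirp z b s) sequentially"
  proof (intro exI conjI)
    show "0 < c" by (rule c)
    show "cball w c \<subseteq> ?S" using cb c by fastforce
    show "uniform_limit (cball w c) F (\<lambda>z. LINT s|lborel. chirp z b s) sequentially"
    proof (rule uniform_limitI)
      fix e :: real assume "e > 0"
      hence "\<forall>\<^sub>F n in sequentially. T n < e"
        using T by (simp add: order_tendsto_iff)
      thus "\<forall>\<^sub>F n in sequentially. \<forall>z\<in>cball w c. dist (F n z) (LINT s|lborel. chirp z b s) < e"
        by eventually_elim (use dist le_less_trans in blast)
    qed
  qed
qed

text \<open>Both sides are holomorphic on the right half-plane and agree on the positive reals,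
  which accumulate at 1, so the identity theorem applies. The principal logarithm selects the branch
  of the square root.\<close>

lemma integral_chirp:
  assumes z: "Re z > 0"
  shows "(LINT s|lborel. chirp z b s) = exp (- Ln z / 2) * exp (- of_real pi * of_real (b\<^sup>2) / z)"
proof -
  let ?S = "{z. Re z > 0}"
  let ?U = "complex_of_real ` {0<..}"
  have "(LINT s|lborel. chirp z b s) - exp (- Ln z / 2) * exp (- of_real pi * of_real (b\<^sup>2) / z) = 0"
  proof (rule analytic_continuation[where U="?U" and S="?S" and \<xi>=1 and
      f="\<lambda>z. (LINT s|lborel. chirp z b s) - exp (- Ln z / 2) * exp (- of_real pi * of_real (b\<^sup>2) / z)"])
    show "(\<lambda>z. (LINT s|lborel. chirp z b s) - exp (- Ln z / 2) * exp (- of_real pi * of_real (b\<^sup>2) / z))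
        holomorphic_on ?S"
      by (intro holomorphic_intros integral_chirp_holomorphic)
        (auto simp: complex_nonpos_Reals_iff)
    show "open ?S" by (rule open_halfspace_Re_gt)
    show "connected ?S" by (intro convex_connected convex_halfspace_Re_gt)
    show "1 islimpt ?U"
      unfolding islimpt_approachable
    proof (intro allI impI)
      fix e :: real assume "e > 0"
      thus "\<exists>x'\<in>?U. x' \<noteq> 1 \<and> dist x' 1 < e"
        by (intro bexI[of _ "of_real (1 + e / 2)"] imageI) (auto simp: dist_norm)
    qed
    fix w assume "w \<in> ?U"
    then obtain r where r: "r > 0" "w = of_real r" by auto
    have "exp (- (of_real (ln r) :: complex) / 2) = of_real (exp (- ln r / 2))"
      by (simp add: exp_of_real[symmetric])
    also have "exp (- ln r / 2) = 1 / sqrt r"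
      using r by (simp add: exp_minus ln_sqrt[symmetric] field_simps)
    finally show "(LINT s|lborel. chirp w b s) - exp (- Ln w / 2) * exp (- of_real pi * of_real (b\<^sup>2) / w) = 0"
      using r by (simp add: integral_chirp_real Ln_of_real exp_of_real[symmetric])
  qed (use z in auto)
  thus ?thesis by simp
qed

lemma norm_exp_half_Ln: "z \<noteq> 0 \<Longrightarrow> cmod (exp (- Ln z / 2)) = cmod z powr (- 1 / 2)"
  by (simp add: powr_def)

section \<open>The operator on Gaussians\<close>

lemma bij_betw_axis_Basis: "bij_betw (\<lambda>i::'n::finite. axis i (1::real)) UNIV Basis"
  unfolding bij_betw_def by (auto simp: inj_on_def axis_eq_axis Basis_vec_def)

text \<open>Fubini for product functions: \<open>lborel\<close> on vectors is the image of a product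
  measure indexed by \<open>Basis\<close>, so the factors are re-indexed from coordinates to basis
  vectors and back.\<close>

lemma
  fixes f :: "'n::finite \<Rightarrow> real \<Rightarrow> 'b::{real_normed_field,banach,second_countable_topology}"
  assumes f: "\<And>i. integrable lborel (f i)"
  shows integrable_prod_vec: "integrable lborel (\<lambda>x::real^'n. \<Prod>i\<in>UNIV. f i (x $ i))"
    and integral_prod_vec: "(LINT x|lborel. (\<Prod>i\<in>UNIV. f i ((x::real^'n) $ i))) = (\<Prod>i\<in>UNIV. LINT s|lborel. f i s)"
proof -
  interpret product_sigma_finite "\<lambda>_::real^'n. lborel :: real measure"
    by standard
  note [measurable] = borel_measurable_integrable[OF f, simplified]
  define J where "J = the_inv_into UNIV (\<lambda>i::'n. axis i (1::real))"
  have J: "J (axis i 1) = i" for i :: 'n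
    unfolding J_def using bij_betw_axis_Basis by (intro the_inv_into_f_f) (auto simp: bij_betw_def)
  let ?P = "\<lambda>x::real^'n. \<Prod>i\<in>UNIV. f i (x $ i)"
  let ?M = "\<Pi>\<^sub>M b\<in>(Basis :: (real^'n) set). (lborel :: real measure)"
  let ?h = "\<lambda>g. \<Sum>b\<in>(Basis :: (real^'n) set). g b *\<^sub>R b"
  have eq: "?P x = (\<Prod>b\<in>Basis. f (J b) (x \<bullet> b))" for x
    using prod.reindex_bij_betw[OF bij_betw_axis_Basis, of "\<lambda>b. f (J b) (x \<bullet> b)"]
    by (simp add: J inner_axis)
  have P: "?P (?h g) = (\<Prod>b\<in>Basis. f (J b) (g b))" for g
    unfolding eq by (intro prod.cong) (auto simp: inner_sum_left_Basis)
  have h[measurable]: "?h \<in> measurable ?M borel"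
    by measurable
  have Pm[measurable]: "?P \<in> borel_measurable borel"
    by measurable
  show "integrable lborel ?P"
    unfolding lborel_eq[where 'a="real^'n"]
    by (subst integrable_distr_eq[OF h Pm])
      (unfold P, intro product_integrable_prod f, simp)
  have "(LINT x|lborel. ?P x) = (LINT g|?M. ?P (?h g))"
    unfolding lborel_eq[where 'a="real^'n"] by (rule integral_distr[OF h Pm])
  also have "\<dots> = (\<Prod>b\<in>Basis. LINT s|lborel. f (J b) s)"
    unfolding P by (intro product_integral_prod f) simp
  also have "\<dots> = (\<Prod>i\<in>UNIV. LINT s|lborel. f i s)"
    using prod.reindex_bij_betw[OF bij_betw_axis_Basis, of "\<lambda>b. LINT s|lborel. f (J b) s"]
    by (simp add: J)
  finally show "(LINT x|lborel. ?P x) = (\<Prod>i\<in>UNIV. LINT s|lborel. f i s)" .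
qed

lemma norm_vec_power2: "(norm (x :: real^'n))\<^sup>2 = (\<Sum>i\<in>UNIV. (x $ i)\<^sup>2)"
  unfolding power2_norm_eq_inner inner_vec_def by (simp add: power2_eq_square)

lemma gauss_prod: "gauss c \<mu> (x :: real^'n) = (\<Prod>i\<in>UNIV. exp (- c * of_real ((x $ i - \<mu> $ i)\<^sup>2)))"
  by (simp add: gauss_def norm_vec_power2 exp_sum[symmetric] sum_distrib_left sum_negf)

text \<open>The shift t = l + s turns the integrand into a unimodular constant times a chirp with
  parameter 1/z, to which the closed formula applies.\<close>

lemma integral_translated_chirp:
  fixes l y :: real
  assumes z: "Re z > 0"
  defines "g \<equiv> \<lambda>t. exp (- (of_real pi / z) * of_real ((t - l)\<^sup>2)) * exp (- 2 * pi * \<i> * of_real (t * y))"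
  shows "integrable lborel g"
    and "(LINT t|lborel. g t) =
      exp (- Ln (1 / z) / 2) * exp (- 2 * pi * \<i> * of_real (l * y)) * exp (- of_real pi * z * of_real (y\<^sup>2))"
proof -
  have z': "Re (1 / z) > 0" using z by (simp add: Re_divide divide_pos_pos sum_power2_gt_zero_iff)
  have z0: "z \<noteq> 0" using z by auto
  have g: "g (l + 1 * s) = exp (- 2 * pi * \<i> * of_real (l * y)) * chirp (1 / z) (- y) s" for s
    unfolding g_def chirp_def exp_add[symmetric] using z0
    by (intro arg_cong[of _ _ exp]) (simp add: field_simps)
  have "integrable lborel (\<lambda>s. g (l + 1 * s))"
    unfolding g by (intro integrable_mult_right integrable_chirp z')
  thus "integrable lborel g" by (subst (asm) lborel_integrable_real_affine_iff) auto
  have "(LINT t|lborel. g t) = (LINT s|lborel. g (l + 1 * s))"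
    by (subst lborel_integral_real_affine[where c=1 and t=l]) auto
  also have "\<dots> = exp (- 2 * pi * \<i> * of_real (l * y)) *
      (exp (- Ln (1 / z) / 2) * exp (- of_real pi * of_real ((- y)\<^sup>2) / (1 / z)))"
    unfolding g using integral_chirp[OF z', of "- y"] by simp
  finally show "(LINT t|lborel. g t) =
      exp (- Ln (1 / z) / 2) * exp (- 2 * pi * \<i> * of_real (l * y)) * exp (- of_real pi * z * of_real (y\<^sup>2))"
    by (simp add: mult_ac)
qed

lemma fourier_gauss:
  fixes \<eta> :: "real^'n"
  assumes z: "Re z > 0"
  shows "fourier (gauss (of_real pi / z) (vec l)) \<eta> = (\<Prod>i\<in>UNIV. exp (- Ln (1 / z) / 2) *
    exp (- 2 * pi * \<i> * of_real (l * \<eta> $ i)) * exp (- of_real pi * z * of_real ((\<eta> $ i)\<^sup>2)))"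
proof -
  have eq: "gauss (of_real pi / z) (vec l) t * exp (- 2 * pi * \<i> * (t \<bullet> \<eta>)) =
      (\<Prod>i\<in>UNIV. exp (- (of_real pi / z) * of_real ((t $ i - l)\<^sup>2)) * exp (- 2 * pi * \<i> * of_real (t $ i * \<eta> $ i)))"
    for t :: "real^'n"
    by (simp add: gauss_prod prod.distrib inner_vec_def exp_sum[symmetric] sum_distrib_left sum_negf mult_ac)
  show ?thesis
    unfolding fourier_def eq
    by (subst integral_prod_vec[OF integral_translated_chirp(1)[OF z]])
      (simp only: integral_translated_chirp(2)[OF z])
qed

lemma integrable_cutoff_chirp:
  assumes [measurable]: "\<psi> \<in> borel_measurable borel"
    and \<psi>: "\<And>s. 0 \<le> \<psi> s" "\<And>s. \<psi> s \<le> (1::real)" and z: "Re z > 0"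
  shows "integrable lborel (\<lambda>s. of_real (\<psi> s) * chirp z b s)"
proof (rule Bochner_Integration.integrable_bound)
  show "integrable lborel (chirp z b)" using z by (rule integrable_chirp)
  show "AE s in lborel. norm (of_real (\<psi> s) * chirp z b s) \<le> norm (chirp z b s)"
    using \<psi> by (auto simp: norm_mult intro!: mult_left_le_one_le)
qed measurable

text \<open>On the support of \<open>\<psi>\<close> the phase is quadratic, so it merges with the
  exponent of the transformed Gaussian: the quadratic coefficient z becomes z - 2iay and the
  frequency becomes y - l. Everything factors over the coordinates.\<close>

lemma FIO_gauss:
  fixes x :: "real^'n" and \<phi> \<psi> :: "real \<Rightarrow> real"
  assumes z: "Re z > 0" and \<psi>m: "\<psi> \<in> borel_measurable borel"
    and \<psi>: "\<And>s. 0 \<le> \<psi> s" "\<And>s. \<psi> s \<le> 1" "\<And>s. \<bar>s\<bar> > 1/2 \<Longrightarrow> \<psi> s = 0"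
    and \<phi>: "\<And>s. \<bar>s\<bar> \<le> 1/2 \<Longrightarrow> \<phi> s = s + a * s\<^sup>2"
  shows "FIO (\<lambda>x \<eta>. \<Sum>k\<in>UNIV. \<phi> (\<eta> $ k) * x $ k)
      (\<lambda>(x, \<eta>). bracket_power m x * (\<Prod>k\<in>UNIV. of_real (\<psi> (\<eta> $ k)))) (gauss (of_real pi / z) (vec l)) x =
    bracket_power m x * (\<Prod>k\<in>UNIV. exp (- Ln (1 / z) / 2) *
      (LINT s|lborel. of_real (\<psi> s) * chirp (z - 2 * \<i> * of_real (a * x $ k)) (x $ k - l) s))"
proof -
  let ?\<kappa> = "exp (- Ln (1 / z) / 2)"
  let ?c = "\<lambda>y s. chirp (z - 2 * \<i> * of_real (a * y)) (y - l) s"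
  have factor: "exp (2 * pi * \<i> * of_real (\<phi> s * y)) * of_real (\<psi> s) *
      (?\<kappa> * exp (- 2 * pi * \<i> * of_real (l * s)) * exp (- of_real pi * z * of_real (s\<^sup>2))) =
      ?\<kappa> * (of_real (\<psi> s) * ?c y s)" for s y
  proof (cases "\<bar>s\<bar> \<le> 1/2")
    case True
    have "exp (2 * pi * \<i> * of_real (\<phi> s * y)) * exp (- 2 * pi * \<i> * of_real (l * s)) *
        exp (- of_real pi * z * of_real (s\<^sup>2)) = ?c y s"
      unfolding chirp_def exp_add[symmetric] \<phi>[OF True]
      by (intro arg_cong[of _ _ exp]) (simp add: algebra_simps)
    thus ?thesis by (simp only: mult_ac flip: \<open>_ = ?c y s\<close>)
  qed (use \<psi> in auto)
  have int: "integrable lborel (\<lambda>s. of_real (\<psi> s) * ?c y s)" for y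
    using z by (intro integrable_cutoff_chirp \<psi>m \<psi>) simp
  have eq: "exp (2 * pi * \<i> * (\<Sum>k\<in>UNIV. \<phi> (\<eta> $ k) * x $ k)) *
      (bracket_power m x * (\<Prod>k\<in>UNIV. of_real (\<psi> (\<eta> $ k)))) * fourier (gauss (of_real pi / z) (vec l)) \<eta> =
      bracket_power m x * (\<Prod>k\<in>UNIV. ?\<kappa> * (of_real (\<psi> (\<eta> $ k)) * ?c (x $ k) (\<eta> $ k)))" for \<eta>
    unfolding fourier_gauss[OF z] factor[symmetric] prod.distrib
    by (simp add: exp_sum sum_distrib_left mult_ac)
  have "FIO (\<lambda>x \<eta>. \<Sum>k\<in>UNIV. \<phi> (\<eta> $ k) * x $ k)
      (\<lambda>(x, \<eta>). bracket_power m x * (\<Prod>k\<in>UNIV. of_real (\<psi> (\<eta> $ k)))) (gauss (of_real pi / z) (vec l)) x =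
      (LINT \<eta>|lborel. bracket_power m x * (\<Prod>k\<in>UNIV. ?\<kappa> * (of_real (\<psi> (\<eta> $ k)) * ?c (x $ k) (\<eta> $ k))))"
    unfolding FIO_def by (simp only: case_prod_conv eq)
  also have "\<dots> = bracket_power m x * (\<Prod>k\<in>UNIV. LINT s|lborel. ?\<kappa> * (of_real (\<psi> s) * ?c (x $ k) s))"
    by (simp only: integral_mult_right_zero integral_prod_vec[OF integrable_mult_right[OF int]])
  finally show ?thesis by (simp only: integral_mult_right_zero)
qed

section \<open>Norm estimates\<close>

lemma enn2real_inverse:
  assumes "1 \<le> (p::ennreal)" "p < \<infinity>"
  shows "1 \<le> enn2real p" "enn2real (1 / p) = 1 / enn2real p"
proof -
  obtain q where q: "p = ennreal q" "q \<ge> 0" using assms(2) by (cases p) auto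
  have "q \<ge> 1" using assms(1) q by (simp add: ennreal_le_iff flip: ennreal_1)
  thus "1 \<le> enn2real p" using q by simp
  have "1 / ennreal q = ennreal (1 / q)"
    using divide_ennreal[of 1 q] \<open>q \<ge> 1\<close> by simp
  thus "enn2real (1 / p) = 1 / enn2real p" using q by simp
qed

text \<open>|f| is a real Gaussian with parameter \<open>\<rho>\<close> = Re (1/z). For finite p the
  exact integral has \<open>\<rho>\<close> q in place of \<open>\<rho>\<close>, and q \<ge> 1 lets q
  be dropped. For p = \<infinity> the exponent is 0 and the bound reads 1.\<close>

lemma
  fixes \<mu> :: "real^'n"
  assumes z: "Re z > 0" and p: "1 \<le> p"
  defines "f \<equiv> gauss (of_real pi / z) \<mu>"
  shows gauss_in_Lp_space: "f \<in> Lp_space p"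
    and Lp_norm_gauss: "Lp_norm p f \<le> (cmod z / sqrt (Re z)) powr (real CARD('n) * enn2real (1 / p))"
proof -
  define \<rho> where "\<rho> = Re z / (cmod z)\<^sup>2"
  have z0: "z \<noteq> 0" using z by auto
  have \<rho>: "\<rho> > 0" using z z0 by (simp add: \<rho>_def)
  have \<rho>': "1 / sqrt \<rho> = cmod z / sqrt (Re z)" using z by (simp add: \<rho>_def real_sqrt_divide)
  have Re: "Re (of_real pi / z) = pi * \<rho>" by (simp add: \<rho>_def Re_divide cmod_power2)
  have nf: "cmod (f x) = exp (- pi * \<rho> * (norm (x - \<mu>))\<^sup>2)" for x
    unfolding f_def norm_gauss Re by simp
  have fm[measurable]: "f \<in> borel_measurable borel"
    unfolding f_def gauss_def[abs_def]
    by (intro borel_measurable_continuous_onI continuous_intros)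
  have "f \<in> Lp_space p \<and> Lp_norm p f \<le> (1 / sqrt \<rho>) powr (real CARD('n) * enn2real (1 / p))"
  proof (cases "p = \<infinity>")
    case True
    have "esssup lborel (\<lambda>x. ennreal (cmod (f x))) \<le> 1"
      using \<rho> by (intro esssup_I AE_I2) (auto simp: nf)
    moreover from this have "esssup lborel (\<lambda>x. ennreal (cmod (f x))) < \<infinity>"
      by (rule le_less_trans) simp
    moreover from calculation have "enn2real (esssup lborel (\<lambda>x. ennreal (cmod (f x)))) \<le> 1"
      by (intro enn2real_leI) auto
    ultimately show ?thesis using True \<rho> fm by (simp add: Lp_space_def Lp_norm_def)
  next
    case False
    hence "p < \<infinity>" by (simp add: less_top)
    note q = enn2real_inverse[OF p this]
    define q where "q = enn2real p"
    have q1: "q \<ge> 1" using q by (simp add: q_def)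
    have eq: "cmod (f x) powr q = (\<Prod>i\<in>UNIV. exp (- pi * (\<rho> * q) * (x $ i - \<mu> $ i)\<^sup>2))" for x
      unfolding nf norm_vec_power2
      by (simp add: powr_def exp_sum[symmetric] sum_distrib_left sum_negf mult_ac)
    have \<rho>q: "\<rho> * q > 0" using \<rho> q1 by simp
    note gi = gaussian_integral[OF \<rho>q]
    have int: "integrable lborel (\<lambda>x. cmod (f x) powr q)"
      unfolding eq by (intro integrable_prod_vec gi)
    have "(LINT x|lborel. cmod (f x) powr q) = (1 / sqrt (\<rho> * q)) ^ CARD('n)"
      unfolding eq by (subst integral_prod_vec[OF gi(1)]) (simp add: gi(2)[simplified])
    also have "\<dots> \<le> (1 / sqrt \<rho>) ^ CARD('n)"
      using \<rho> q1 by (intro power_mono divide_left_mono) (auto simp: mult_le_cancel_left1)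
    finally have le: "(LINT x|lborel. cmod (f x) powr q) \<le> (1 / sqrt \<rho>) ^ CARD('n)" .
    have "Lp_norm p f = (LINT x|lborel. cmod (f x) powr q) powr (1 / q)"
      using False by (simp add: Lp_norm_def q_def)
    also have "\<dots> \<le> ((1 / sqrt \<rho>) ^ CARD('n)) powr (1 / q)"
      using le q1 by (intro powr_mono2) auto
    also have "(1 / sqrt \<rho>) ^ CARD('n) = (1 / sqrt \<rho>) powr real CARD('n)"
      using \<rho> by (intro powr_realpow[symmetric]) simp
    also have "\<dots> powr (1 / q) = (1 / sqrt \<rho>) powr (real CARD('n) * (1 / q))"
      by (rule powr_powr)
    finally show ?thesis using False int fm q(2) by (simp add: Lp_space_def q_def)
  qed
  thus "f \<in> Lp_space p" "Lp_norm p f \<le> (cmod z / sqrt (Re z)) powr (real CARD('n) * enn2real (1 / p))"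
    by (simp_all only: \<rho>')
qed

text \<open>For finite p, integrate over the box only. For p = \<infinity>, an essential supremum
  below c would make the box a null set; the exponent is then 0, and positive volume makes the power
  equal to 1.\<close>

lemma Lp_norm_ge:
  fixes h A :: "real^'n \<Rightarrow> complex"
  assumes h: "h \<in> Lp_space p" and p: "1 \<le> p" and ae: "AE x in lborel. h x = A x"
    and c: "c > 0" "\<And>x. x \<in> cbox u v \<Longrightarrow> c \<le> cmod (A x)" and vol: "measure lborel (cbox u v) > 0"
  shows "c * measure lborel (cbox u v) powr enn2real (1 / p) \<le> Lp_norm p h"
proof (cases "p = \<infinity>")
  case True
  let ?E = "esssup lborel (\<lambda>x. ennreal (cmod (h x)))"
  have E: "?E < \<infinity>" using h True by (simp add: Lp_space_def)
  have "ennreal c \<le> ?E"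
  proof (rule ccontr)
    assume "\<not> ennreal c \<le> ?E"
    have "AE x in lborel. x \<notin> cbox u v"
      using esssup_AE[where M=lborel and f="\<lambda>x. ennreal (cmod (h x))"] ae
    proof eventually_elim
      case (elim x)
      show ?case
      proof
        assume "x \<in> cbox u v"
        hence "ennreal c \<le> ennreal (cmod (h x))" using c(2) elim(2) by (simp add: ennreal_leI)
        thus False using elim(1) \<open>\<not> ennreal c \<le> ?E\<close> by (meson order_trans)
      qed
    qed
    hence "cbox u v \<in> null_sets lborel" by (subst (asm) AE_iff_null_sets[symmetric]) auto
    thus False using vol by (simp add: null_sets_def measure_def)
  qed
  hence "enn2real (ennreal c) \<le> enn2real ?E" using E by (intro enn2real_mono) auto
  thus ?thesis using True c(1) vol by (simp add: Lp_norm_def)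
next
  case False
  hence "p < \<infinity>" by (simp add: less_top)
  note q = enn2real_inverse[OF p this]
  define q where "q = enn2real p"
  have q1: "q \<ge> 1" using q by (simp add: q_def)
  have int: "integrable lborel (\<lambda>x. cmod (h x) powr q)"
    using h False by (simp add: Lp_space_def q_def)
  have "(LINT x|lborel. c powr q * indicator (cbox u v) x) \<le> (LINT x|lborel. cmod (h x) powr q)"
  proof (rule integral_mono_AE)
    show "integrable lborel (\<lambda>x. c powr q * indicator (cbox u v) x :: real)"
      by (intro integrable_mult_right integrable_real_indicator) (auto simp: emeasure_lborel_cbox_eq)
    show "AE x in lborel. c powr q * indicator (cbox u v) x \<le> cmod (h x) powr q"
      using ae by eventually_elim (use c q1 in \<open>auto simp: indicator_def intro!: powr_mono2\<close>)
  qed (rule int)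
  hence "c powr q * measure lborel (cbox u v) \<le> (LINT x|lborel. cmod (h x) powr q)" by simp
  hence "(c powr q * measure lborel (cbox u v)) powr (1 / q) \<le> (LINT x|lborel. cmod (h x) powr q) powr (1 / q)"
    using c q1 vol by (intro powr_mono2) auto
  moreover have "(c powr q * measure lborel (cbox u v)) powr (1 / q) = c * measure lborel (cbox u v) powr (1 / q)"
    using c q1 vol by (simp add: powr_mult powr_powr)
  ultimately show ?thesis using False q(2) by (simp add: Lp_norm_def q_def)
qed

lemma measure_cube:
  assumes "\<alpha> < \<beta>"
  shows "measure lborel (cbox (vec \<alpha>) (vec \<beta> :: real^'n)) = (\<beta> - \<alpha>) ^ CARD('n)"
proof -
  have "vec \<alpha> \<in> cbox (vec \<alpha>) (vec \<beta> :: real^'n)" using assms by (simp add: mem_box_cart)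
  hence "cbox (vec \<alpha>) (vec \<beta> :: real^'n) \<noteq> {}" by blast
  thus ?thesis by (simp add: content_cbox_cart)
qed

text \<open>Reduces an extension on any V in this range to a norm inequality on Schwartz functions,
  which is all that the test functions use. The maximum with 1 makes the constant positive.\<close>

lemma bounded_extension_schwartz:
  fixes A :: "(real^'n \<Rightarrow> complex) \<Rightarrow> real^'n \<Rightarrow> complex"
  assumes "extends_to_bounded_operator_on p V A" "schwartz \<inter> Lp_space p \<subseteq> V" "V \<subseteq> Lp_space p"
  shows "\<exists>C>0. \<forall>f\<in>schwartz \<inter> Lp_space p.
    \<exists>h\<in>Lp_space p. (AE x in lborel. h x = A f x) \<and> Lp_norm p h \<le> C * Lp_norm p f"
proof -
  obtain T C where T: "\<And>f. f \<in> V \<Longrightarrow> T f \<in> V" "\<And>f. f \<in> V \<Longrightarrow> Lp_norm p (T f) \<le> C * Lp_norm p f"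
    "\<And>f. f \<in> schwartz \<Longrightarrow> AE x in lborel. T f x = A f x"
    using assms(1) unfolding extends_to_bounded_operator_on_def bounded_operator_on_def by blast
  have nn: "0 \<le> Lp_norm p f" for f :: "real^'n \<Rightarrow> complex" by (simp add: Lp_norm_def)
  show ?thesis
  proof (intro exI[of _ "max C 1"] conjI ballI)
    fix f :: "real^'n \<Rightarrow> complex" assume f: "f \<in> schwartz \<inter> Lp_space p"
    hence "f \<in> V" using assms(2) by blast
    moreover have "C * Lp_norm p f \<le> max C 1 * Lp_norm p f" using nn by (intro mult_right_mono) auto
    ultimately show "\<exists>h\<in>Lp_space p. (AE x in lborel. h x = A f x) \<and> Lp_norm p h \<le> max C 1 * Lp_norm p f"
      using T f assms(3) by (intro bexI[of _ "T f"]) (auto intro: order_trans)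
  qed simp
qed

text \<open>On these cubes the bracket lies between l/2 and a constant times l. The sign of m
  decides which of the two comparisons gives the lower bound, hence the minimum.\<close>

lemma jbracket_powr_ge:
  fixes m :: real
  shows "\<exists>K>0. \<forall>l\<ge>1. \<forall>x::real^'n. (\<forall>k. l / 2 \<le> x $ k \<and> x $ k \<le> 2 * l) \<longrightarrow>
    K * l powr m \<le> jbracket x powr m"
proof -
  define B where "B = sqrt (1 + 4 * real CARD('n))"
  have B: "B > 0" by (simp add: B_def add_pos_nonneg)
  show ?thesis
  proof (intro exI[of _ "min ((1 / 2) powr m) (B powr m)"] conjI allI impI)
    show "min ((1 / 2) powr m) (B powr m) > 0" using B by simp
    fix l and x :: "real^'n" assume l: "l \<ge> 1" and "\<forall>k. l / 2 \<le> x $ k \<and> x $ k \<le> 2 * l"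
    hence x: "l / 2 \<le> x $ k \<and> x $ k \<le> 2 * l" for k by blast
    have "l / 2 \<le> norm x"
      using component_le_norm_cart[of x undefined] x[of undefined] l by linarith
    hence lo: "1 / 2 * l \<le> jbracket x" using norm_le_jbracket[of x] by simp
    have "(norm x)\<^sup>2 \<le> (\<Sum>k\<in>(UNIV::'n set). (2 * l)\<^sup>2)"
      unfolding norm_vec_power2
    proof (intro sum_mono power_mono)
      show "x $ k \<le> 2 * l" "0 \<le> x $ k" for k using x[of k] l by auto
    qed
    hence "1 + (norm x)\<^sup>2 \<le> l\<^sup>2 + 4 * real CARD('n) * l\<^sup>2"
      using one_le_power[OF l, of 2] by (simp only: sum_constant) (simp add: power_mult_distrib)
    also have "\<dots> = (B * l)\<^sup>2" by (simp add: B_def power_mult_distrib algebra_simps)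
    finally have hi: "jbracket x \<le> B * l"
      unfolding jbracket_def using B l by (intro real_le_lsqrt) auto
    show "min ((1 / 2) powr m) (B powr m) * l powr m \<le> jbracket x powr m"
    proof (cases "m \<ge> 0")
      case True
      have "min ((1 / 2) powr m) (B powr m) * l powr m \<le> (1 / 2) powr m * l powr m"
        by (intro mult_right_mono) auto
      also have "\<dots> = (1 / 2 * l) powr m" by (rule powr_mult[symmetric])
      also have "\<dots> \<le> jbracket x powr m" using lo l True by (intro powr_mono2) auto
      finally show ?thesis .
    next
      case False
      have "min ((1 / 2) powr m) (B powr m) * l powr m \<le> B powr m * l powr m"
        by (intro mult_right_mono) auto
      also have "\<dots> = (B * l) powr m" using l B by (simp add: powr_mult)
      also have "\<dots> \<le> jbracket x powr m"
        using hi jbracket_pos[of x] False by (intro powr_mono2') auto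
      finally show ?thesis .
    qed
  qed
qed

section \<open>Lower bounds for the one-dimensional oscillatory integrals\<close>

context
  fixes \<psi> :: "real \<Rightarrow> real" and a :: real
  assumes \<psi>_measurable [measurable]: "\<psi> \<in> borel_measurable borel"
    and \<psi>: "\<And>s. 0 \<le> \<psi> s" "\<And>s. \<psi> s \<le> 1" "\<And>s. \<bar>s\<bar> > 1/2 \<Longrightarrow> \<psi> s = 0" "\<And>s. \<bar>s\<bar> \<le> 1/4 \<Longrightarrow> \<psi> s = 1"
    and a: "a > 0"
begin

text \<open>For z = 1 + 2ial and y = l + u the quadratic phase nearly cancels. The bound on u keeps
  the remaining phase within [-1, 1] on the support of \<open>\<psi>\<close>, so its cosine is at
  least 1/2 and the real part cannot cancel. The constant comes from the interval [-1/4, 1/4]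
  alone.\<close>

lemma cutoff_chirp_ge_focused:
  assumes u: "\<bar>u\<bar> \<le> 1 / (pi * (1 + a))"
  shows "exp (- pi) / 4 \<le> cmod (LINT s|lborel. of_real (\<psi> s) * chirp (1 - 2 * \<i> * of_real (a * u)) u s)"
proof -
  let ?g = "\<lambda>s. of_real (\<psi> s) * chirp (1 - 2 * \<i> * of_real (a * u)) u s"
  have int: "integrable lborel ?g" by (rule integrable_cutoff_chirp[OF \<psi>_measurable \<psi>(1,2)]) simp
  have Re: "Re (?g s) = \<psi> s * (exp (- pi * s\<^sup>2) * cos (2 * pi * u * (s + a * s\<^sup>2)))" for s
    by (simp add: chirp_def Re_exp algebra_simps)
  have ge: "exp (- pi) / 2 * indicator {-1/4..1/4} s \<le> Re (?g s)" for s
  proof (cases "\<bar>s\<bar> \<le> 1/2")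
    case True
    have s2: "s\<^sup>2 \<le> 1/4" using power_mono[OF True, of 2] by (simp add: power2_eq_square)
    have "\<bar>s + a * s\<^sup>2\<bar> \<le> \<bar>s\<bar> + \<bar>a * s\<^sup>2\<bar>" by (rule abs_triangle_ineq)
    also have "\<dots> \<le> 1/2 + a * (1/4)"
      using True s2 a by (intro add_mono) (auto simp: abs_mult)
    also have "\<dots> \<le> (1 + a) / 2" using a by simp
    finally have "\<bar>u\<bar> * \<bar>s + a * s\<^sup>2\<bar> \<le> 1 / (pi * (1 + a)) * ((1 + a) / 2)"
      using u a by (intro mult_mono) auto
    also have "1 / (pi * t) * (t / 2) = 1 / (2 * pi)" if "t > 0" for t
      using that by (simp add: field_simps)
    from this[of "1 + a"] have "1 / (pi * (1 + a)) * ((1 + a) / 2) = 1 / (2 * pi)" using a by simp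
    finally have "2 * pi * (\<bar>u\<bar> * \<bar>s + a * s\<^sup>2\<bar>) \<le> 2 * pi * (1 / (2 * pi))"
      by (intro mult_left_mono) auto
    moreover have "\<bar>2 * pi * u * (s + a * s\<^sup>2)\<bar> = 2 * pi * (\<bar>u\<bar> * \<bar>s + a * s\<^sup>2\<bar>)"
      by (simp only: abs_mult mult.assoc abs_numeral abs_of_pos[OF pi_gt_zero])
    ultimately have "\<bar>2 * pi * u * (s + a * s\<^sup>2)\<bar> \<le> 1" by simp
    moreover have "1 \<le> pi / 3" using pi_gt3 by simp
    ultimately have "cos (pi / 3) \<le> cos \<bar>2 * pi * u * (s + a * s\<^sup>2)\<bar>"
      using pi_gt3 by (subst cos_mono_le_eq) auto
    hence cs: "1 / 2 \<le> cos (2 * pi * u * (s + a * s\<^sup>2))"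
      by (simp add: cos_60)
    have "exp (- pi) \<le> exp (- pi * s\<^sup>2)" using s2 by (simp add: mult_le_cancel_left1)
    hence "exp (- pi) * (1 / 2) \<le> exp (- pi * s\<^sup>2) * cos (2 * pi * u * (s + a * s\<^sup>2))"
      using cs by (intro mult_mono) auto
    thus ?thesis unfolding Re using \<psi>(1)[of s] \<psi>(4)[of s] cs
      by (auto simp: indicator_def abs_le_iff)
  next
    case False
    thus ?thesis unfolding Re using \<psi>(3)[of s] by (auto simp: indicator_def)
  qed
  have ind: "integrable lborel (indicator {-1/4..1/4::real} :: real \<Rightarrow> real)"
    by (intro integrable_real_indicator emeasure_bounded_finite) auto
  have "exp (- pi) / 4 = (LINT s|lborel. exp (- pi) / 2 * indicator {-1/4..1/4::real} s)"
    by simp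
  also have "\<dots> \<le> (LINT s|lborel. Re (?g s))"
    using ge int ind by (intro integral_mono integrable_mult_right integrable_Re)
  also have "\<dots> = Re (LINT s|lborel. ?g s)" using int by (rule integral_Re)
  also have "\<dots> \<le> cmod (LINT s|lborel. ?g s)" by (rule complex_Re_le_cmod)
  finally show ?thesis .
qed

text \<open>Without the cutoff the modulus is |w|^(-1/2) exp(-\<pi> M (y - l)^2 / |w|^2) with |w|
  comparable to l. The range of y keeps the exponent bounded below; the subtracted term is the price
  of the cutoff.\<close>

lemma cutoff_chirp_ge_spread:
  assumes M: "M \<ge> 1" and l: "l \<ge> M" and y: "l \<le> y" "y \<le> l + l / sqrt M"
  shows "sqrt (1 + 16 * a\<^sup>2) powr (- 1 / 2) * exp (- pi / (4 * a\<^sup>2)) * l powr (- 1 / 2) - exp (- pi * (M - 1) / 16)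
    \<le> cmod (LINT s|lborel. of_real (\<psi> s) * chirp (of_real M - 2 * \<i> * of_real (a * y)) (y - l) s)"
proof -
  define w where "w = of_real M - 2 * \<i> * of_real (a * y)"
  have Rw: "Re w = M" by (simp add: w_def)
  have Rw0: "Re w > 0" using M Rw by simp
  have w0: "w \<noteq> 0" using Rw0 by auto
  have w2: "(cmod w)\<^sup>2 = M\<^sup>2 + 4 * a\<^sup>2 * y\<^sup>2"
    by (simp add: cmod_power2 w_def power_mult_distrib)
  have "l / sqrt M \<le> l" using M l by (simp add: divide_le_eq mult_le_cancel_left1)
  hence y2: "y \<le> 2 * l" using y by linarith
  have "(cmod w)\<^sup>2 \<le> l\<^sup>2 + 4 * a\<^sup>2 * (2 * l)\<^sup>2"
    unfolding w2 using M l y y2 by (intro add_mono mult_left_mono power_mono) auto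
  also have "\<dots> = (sqrt (1 + 16 * a\<^sup>2) * l)\<^sup>2" by (simp add: power_mult_distrib algebra_simps)
  finally have w_le: "cmod w \<le> sqrt (1 + 16 * a\<^sup>2) * l"
    using M l by (intro power2_le_imp_le[of "cmod w"]) auto
  have "(y - l)\<^sup>2 \<le> (l / sqrt M)\<^sup>2" using y by (intro power_mono) auto
  hence yl: "(y - l)\<^sup>2 * M \<le> l\<^sup>2" using M by (simp add: power_divide field_simps)
  \<comment> \<open>The imaginary part of w alone gives |w| \<ge> 2al, which balances (y - l)^2 M
    \<le> l^2.\<close>
  have "4 * a\<^sup>2 * l\<^sup>2 \<le> (cmod w)\<^sup>2"
    unfolding w2 using M l y by (intro add_increasing mult_left_mono power_mono) auto
  hence "(y - l)\<^sup>2 * M * (4 * a\<^sup>2) \<le> (cmod w)\<^sup>2 * 1"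
    using mult_right_mono[OF yl, of "4 * a\<^sup>2"] by (simp add: mult_ac)
  hence ratio: "(y - l)\<^sup>2 * M / (cmod w)\<^sup>2 \<le> 1 / (4 * a\<^sup>2)"
    using w0 a by (simp add: divide_le_eq pos_le_divide_eq mult_ac)
  have "Re (- of_real pi * of_real ((y - l)\<^sup>2) / w) = - pi * ((y - l)\<^sup>2 * M / (cmod w)\<^sup>2)"
    by (simp add: Re_divide cmod_power2 Rw[symmetric])
  also have "\<dots> \<ge> - pi * (1 / (4 * a\<^sup>2))"
    using ratio by (intro mult_left_mono_neg) auto
  finally have "exp (- pi / (4 * a\<^sup>2)) \<le> cmod (exp (- of_real pi * of_real ((y - l)\<^sup>2) / w))"
    by simp
  moreover have "(sqrt (1 + 16 * a\<^sup>2) * l) powr (- 1 / 2) \<le> cmod w powr (- 1 / 2)"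
    using w_le w0 by (intro powr_mono2') auto
  ultimately have "(sqrt (1 + 16 * a\<^sup>2) * l) powr (- 1 / 2) * exp (- pi / (4 * a\<^sup>2)) \<le>
      cmod (LINT s|lborel. chirp w (y - l) s)"
    unfolding integral_chirp[OF Rw0] norm_mult norm_exp_half_Ln[OF w0] by (intro mult_mono) auto
  moreover have "(sqrt (1 + 16 * a\<^sup>2) * l) powr (- 1 / 2) = sqrt (1 + 16 * a\<^sup>2) powr (- 1 / 2) * l powr (- 1 / 2)"
    using M l by (intro powr_mult)
  ultimately have full: "sqrt (1 + 16 * a\<^sup>2) powr (- 1 / 2) * exp (- pi / (4 * a\<^sup>2)) * l powr (- 1 / 2) \<le>
      cmod (LINT s|lborel. chirp w (y - l) s)"
    by (simp add: mult_ac)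
  note ic = integrable_chirp[OF Rw0, of "y - l"] and ig = integrable_cutoff_chirp[OF \<psi>_measurable \<psi>(1,2) Rw0, of "y - l"]
  have "cmod (LINT s|lborel. chirp w (y - l) s - of_real (\<psi> s) * chirp w (y - l) s) \<le>
      (LINT s|lborel. exp (- pi * (M - 1) / 16) * exp (- pi * 1 * (s - 0)\<^sup>2))"
  proof (rule Bochner_Integration.integral_norm_bound_integral)
    show "integrable lborel (\<lambda>s. chirp w (y - l) s - of_real (\<psi> s) * chirp w (y - l) s)"
      using ic ig by (rule Bochner_Integration.integrable_diff)
    show "integrable lborel (\<lambda>s. exp (- pi * (M - 1) / 16) * exp (- pi * 1 * (s - 0)\<^sup>2))"
      by (intro integrable_mult_right gaussian_integral) simp
    fix s :: real
    have "chirp w (y - l) s - of_real (\<psi> s) * chirp w (y - l) s = of_real (1 - \<psi> s) * chirp w (y - l) s"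
      by (simp add: algebra_simps)
    hence "cmod (chirp w (y - l) s - of_real (\<psi> s) * chirp w (y - l) s) = (1 - \<psi> s) * exp (- pi * M * s\<^sup>2)"
      using \<psi>(2)[of s] by (simp only: norm_mult norm_of_real norm_chirp Rw)
    \<comment> \<open>Split M as (M - 1) + 1: where the cutoff differs from 1, s^2 \<ge> 1/16 makes
      the first part small, and the second leaves a Gaussian of integral 1.\<close>
    also have "\<dots> \<le> exp (- pi * (M - 1) / 16) * exp (- pi * 1 * (s - 0)\<^sup>2)"
    proof (cases "\<bar>s\<bar> \<le> 1/4")
      case True
      thus ?thesis using \<psi>(4) by simp
    next
      case False
      hence "(1/4)\<^sup>2 \<le> \<bar>s\<bar>\<^sup>2" by (intro power_mono) auto
      hence "(M - 1) * (1/16) \<le> (M - 1) * s\<^sup>2"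
        using M by (intro mult_left_mono) (auto simp: power2_eq_square)
      hence "pi * ((M - 1) * (1/16)) \<le> pi * ((M - 1) * s\<^sup>2)"
        by (rule mult_left_mono) simp
      moreover have "pi * M * s\<^sup>2 = pi * ((M - 1) * s\<^sup>2) + pi * s\<^sup>2"
        by (simp add: algebra_simps)
      ultimately have "- pi * M * s\<^sup>2 \<le> - pi * (M - 1) / 16 + - pi * s\<^sup>2" by simp
      hence "exp (- pi * M * s\<^sup>2) \<le> exp (- pi * (M - 1) / 16) * exp (- pi * 1 * (s - 0)\<^sup>2)"
        by (simp add: exp_add[symmetric])
      moreover have "(1 - \<psi> s) * exp (- pi * M * s\<^sup>2) \<le> 1 * exp (- pi * M * s\<^sup>2)"
        using \<psi>(1)[of s] by (intro mult_right_mono) auto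
      ultimately show ?thesis by linarith
    qed
    finally show "cmod (chirp w (y - l) s - of_real (\<psi> s) * chirp w (y - l) s) \<le>
        exp (- pi * (M - 1) / 16) * exp (- pi * 1 * (s - 0)\<^sup>2)" .
  qed
  also have "\<dots> = exp (- pi * (M - 1) / 16)"
    using gaussian_integral(2)[of 1 0] by simp
  finally have "cmod ((LINT s|lborel. chirp w (y - l) s) - (LINT s|lborel. of_real (\<psi> s) * chirp w (y - l) s)) \<le>
      exp (- pi * (M - 1) / 16)"
    using ic ig by simp
  thus ?thesis
    using full norm_triangle_ineq2[of "LINT s|lborel. chirp w (y - l) s" "LINT s|lborel. of_real (\<psi> s) * chirp w (y - l) s"]
    unfolding w_def by linarith
qed

end

section \<open>Unboundedness\<close>

lemma powr_bounded_imp_nonpos: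
  assumes "D > 0" "\<forall>\<^sub>F t in at_top. D * t powr s \<le> (C::real)"
  shows "s \<le> 0"
proof (rule ccontr)
  assume "\<not> s \<le> 0"
  hence "filterlim (\<lambda>t. D * t powr s) at_top at_top"
    using assms(1) by real_asymp
  hence "\<forall>\<^sub>F t in at_top. C < D * t powr s" by (simp add: filterlim_at_top_dense)
  with assms(2) have "\<forall>\<^sub>F t::real in at_top. False" by eventually_elim simp
  thus False by simp
qed

theorem proposition6p1:
  fixes p :: ennreal and m :: real
  assumes "1 \<le> p"
    and "m > - real CARD('n::finite) * \<bar>1/2 - enn2real (1 / p)\<bar>"
  shows "\<exists>(\<phi> :: real \<Rightarrow> real) (\<sigma> :: (real^'n) \<times> (real^'n) \<Rightarrow> complex).
           smooth_diffeo \<phi> \<and> (\<forall>t. \<bar>t\<bar> \<ge> 1 \<longrightarrow> \<phi> t = t) \<and>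
           \<sigma> \<in> SG_minus_inf m \<and> compactly_supported_snd \<sigma> \<and>
           (let A = FIO (\<lambda>x \<eta>. \<Sum>k\<in>UNIV. \<phi> (\<eta> $ k) * x $ k) \<sigma> in
             (p < \<infinity> \<longrightarrow> \<not> extends_to_bounded_operator_on p (Lp_space p) A) \<and>
             (p = \<infinity> \<longrightarrow> \<not> extends_to_bounded_operator_on \<infinity> schwartz_closure_Linf A))"
proof -
  obtain \<phi> :: "real \<Rightarrow> real" and a where \<phi>: "smooth_diffeo \<phi>" "\<And>t. \<bar>t\<bar> \<ge> 1 \<Longrightarrow> \<phi> t = t"
    and a: "a > 0" and \<phi>_quadratic: "\<And>t. \<bar>t\<bar> \<le> 1/2 \<Longrightarrow> \<phi> t = t + a * t\<^sup>2"
    using exists_diffeo_quadratic_near_0 by metis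
  \<comment> \<open>The rescaling puts the support inside |s| \<le> 1/2, where \<open>\<phi>\<close>
    is quadratic.\<close>
  define \<psi> where "\<psi> s = plateau (2 * s)" for s
  have \<psi>: "0 \<le> \<psi> s" "\<psi> s \<le> 1" "\<bar>s\<bar> > 1/2 \<Longrightarrow> \<psi> s = 0" "\<bar>s\<bar> \<le> 1/4 \<Longrightarrow> \<psi> s = 1" for s
    by (auto simp: \<psi>_def plateau_nonneg plateau_le_1 intro!: plateau_eq_0 plateau_eq_1)
  have Ck_\<psi>: "Ck k \<psi>" for k
    using Ck_comp_real[OF _ Ck_mult[OF Ck_const[of k 2] Ck_ident], of plateau] smooth_plateau
    by (simp add: smooth_def \<psi>_def[abs_def])
  have \<psi>m[measurable]: "\<psi> \<in> borel_measurable borel"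
    using Ck_\<psi>[of 0] by (intro borel_measurable_continuous_onI) simp
  define g where "g \<eta> = (\<Prod>k\<in>UNIV. complex_of_real (\<psi> (\<eta> $ k)))" for \<eta> :: "real^'n"
  define \<sigma> where "\<sigma> = (\<lambda>(x :: real^'n, \<eta>). bracket_power m x * g \<eta>)"
  define n where "n = real CARD('n)"
  define e where "e = enn2real (1 / p)"
  have n: "n \<ge> 1" unfolding n_def using one_le_card_finite[where 'a='n] by linarith
  have e: "0 \<le> e" "e \<le> 1"
  proof -
    show "0 \<le> e" by (simp add: e_def)
    show "e \<le> 1"
    proof (cases "p = \<infinity>")
      case False
      thus ?thesis using enn2real_inverse[OF assms(1)] by (auto simp: e_def less_top)
    qed (simp add: e_def)
  qed

  have g_smooth: "smooth g"
    unfolding smooth_def g_def[abs_def]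
  proof (intro allI Ck_prod Ck_of_real)
    show "Ck k (\<lambda>\<eta>::real^'n. \<psi> (\<eta> $ i))" for k i
      by (rule Ck_comp_bounded_linear[OF bounded_linear_vec_nth Ck_\<psi>])
  qed simp
  have g_0: "g \<eta> = 0" if "norm \<eta> \<ge> n" for \<eta>
  proof -
    have "\<exists>k. \<bar>\<eta> $ k\<bar> > 1/2"
    proof (rule ccontr)
      assume "\<not> (\<exists>k. \<bar>\<eta> $ k\<bar> > 1/2)"
      hence "(\<Sum>k\<in>UNIV. \<bar>\<eta> $ k\<bar>) \<le> (\<Sum>k\<in>(UNIV::'n set). 1/2)"
        by (intro sum_mono) (auto simp: not_less)
      hence "norm \<eta> \<le> n / 2" using norm_le_l1_cart[of \<eta>] by (simp add: n_def)
      thus False using that n by linarith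
    qed
    thus ?thesis unfolding g_def using \<psi>(3) by (auto intro!: prod_zero)
  qed
  have \<sigma>_SG: "\<sigma> \<in> SG_minus_inf m"
    unfolding \<sigma>_def using g_0 by (intro tensor_in_SG_minus_inf[OF g_smooth, of n]) auto
  have \<sigma>_supp: "compactly_supported_snd \<sigma>"
    unfolding compactly_supported_snd_def \<sigma>_def using g_0 n by (intro exI[of _ n]) auto

  let ?A = "FIO (\<lambda>x \<eta>. \<Sum>k\<in>UNIV. \<phi> (\<eta> $ k) * x $ k) \<sigma>"
  obtain K where K: "K > 0" "\<forall>l\<ge>1. \<forall>x::real^'n. (\<forall>k. l / 2 \<le> x $ k \<and> x $ k \<le> 2 * l) \<longrightarrow>
      K * l powr m \<le> jbracket x powr m"
    using jbracket_powr_ge[where 'n='n and m=m] by blast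

  \<comment> \<open>Leaving V open treats L^p and the closure of the Schwartz space in L^\<infinity>
    together.\<close>
  have no_extension: "\<not> extends_to_bounded_operator_on p V ?A"
    if V: "schwartz \<inter> Lp_space p \<subseteq> V" "V \<subseteq> Lp_space p" for V
  proof
    assume "extends_to_bounded_operator_on p V ?A"
    from bounded_extension_schwartz[OF this V]
    obtain C where C: "C > 0" "\<forall>f\<in>schwartz \<inter> Lp_space p.
        \<exists>h\<in>Lp_space p. (AE x in lborel. h x = ?A f x) \<and> Lp_norm p h \<le> C * Lp_norm p f"
      by blast
    let ?I = "\<lambda>z l y. LINT s|lborel. of_real (\<psi> s) * chirp (z - 2 * \<i> * of_real (a * y)) (y - l) s"
    \<comment> \<open>The common inequality for both regimes: the left side bounds the norm of A f
      from below on the cube [\<alpha>, \<beta>]^d, given a lower bound c for the one-dimensional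
      integrals. The factor sqrt |z| per coordinate comes from the Fourier transform of the
      Gaussian.\<close>
    have bound: "K * l powr m * (sqrt (cmod z) * c) ^ CARD('n) * (\<beta> - \<alpha>) powr (n * e) \<le>
        C * (cmod z / sqrt (Re z)) powr (n * e)"
      if z: "Re z > 0" and l: "l \<ge> 1" and \<alpha>\<beta>: "\<alpha> < \<beta>" "l / 2 \<le> \<alpha>" "\<beta> \<le> 2 * l" and c: "c > 0"
        and I: "\<And>y. \<alpha> \<le> y \<Longrightarrow> y \<le> \<beta> \<Longrightarrow> c \<le> cmod (?I z l y)"
      for z l \<alpha> \<beta> c
    proof -
      define f where "f = gauss (of_real pi / z) (vec l :: real^'n)"
      have z0: "z \<noteq> 0" using z by auto
      have "Re (of_real pi / z) > 0" using z
        by (simp add: Re_divide divide_pos_pos sum_power2_gt_zero_iff)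
      hence "f \<in> schwartz" unfolding f_def by (rule gauss_schwartz)
      moreover have "f \<in> Lp_space p" unfolding f_def by (rule gauss_in_Lp_space[OF z assms(1)])
      ultimately obtain h where h: "h \<in> Lp_space p" "AE x in lborel. h x = ?A f x"
        "Lp_norm p h \<le> C * Lp_norm p f" using C(2) by blast
      have \<kappa>: "cmod (exp (- Ln (1 / z) / 2)) = sqrt (cmod z)"
        using norm_exp_half_Ln[of "1 / z"] z0
        by (simp add: norm_divide powr_divide powr_minus powr_half_sqrt[symmetric] field_simps)
      let ?c = "K * l powr m * (sqrt (cmod z) * c) ^ CARD('n)"
      have c_pos: "?c > 0" using K(1) l c z0 by simp
      have A_ge: "?c \<le> cmod (?A f x)" if x: "x \<in> cbox (vec \<alpha>) (vec \<beta>)" for x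
      proof -
        have xk: "\<alpha> \<le> x $ k" "x $ k \<le> \<beta>" for k using x by (auto simp: mem_box_cart)
        have eq: "?A f x = bracket_power m x * (\<Prod>k\<in>UNIV. exp (- Ln (1 / z) / 2) * ?I z l (x $ k))"
          unfolding f_def \<sigma>_def g_def by (rule FIO_gauss[OF z \<psi>m \<psi>(1-3) \<phi>_quadratic])
        have "(\<Prod>k\<in>(UNIV::'n set). sqrt (cmod z) * c) \<le>
            (\<Prod>k\<in>UNIV. sqrt (cmod z) * cmod (?I z l (x $ k)))"
          using I xk c by (intro prod_mono conjI mult_left_mono mult_nonneg_nonneg) auto
        moreover have "K * l powr m \<le> jbracket x powr m"
        proof -
          have "l / 2 \<le> x $ k \<and> x $ k \<le> 2 * l" for k using xk[of k] \<alpha>\<beta> by linarith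
          thus ?thesis using K(2) l by blast
        qed
        ultimately have "K * l powr m * (\<Prod>k\<in>(UNIV::'n set). sqrt (cmod z) * c) \<le>
            jbracket x powr m * (\<Prod>k\<in>UNIV. sqrt (cmod z) * cmod (?I z l (x $ k)))"
          using c by (intro mult_mono prod_nonneg) auto
        also have "\<dots> = cmod (?A f x)"
          by (simp only: eq norm_mult prod_norm[symmetric] \<kappa>) (simp add: bracket_power_def)
        finally show ?thesis by simp
      qed
      have vol: "measure lborel (cbox (vec \<alpha>) (vec \<beta> :: real^'n)) = (\<beta> - \<alpha>) powr n"
        using measure_cube[OF \<alpha>\<beta>(1), where 'n='n] \<alpha>\<beta>(1) by (simp add: n_def powr_realpow)
      have "?c * (\<beta> - \<alpha>) powr (n * e) \<le> Lp_norm p h"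
        using Lp_norm_ge[where u="vec \<alpha>" and v="vec \<beta>", OF h(1) assms(1) h(2) c_pos A_ge] \<alpha>\<beta>(1)
        by (simp add: vol powr_powr e_def)
      also have "\<dots> \<le> C * Lp_norm p f" by (rule h)
      also have "\<dots> \<le> C * (cmod z / sqrt (Re z)) powr (n * e)"
        using C(1) Lp_norm_gauss[OF z assms(1), of "vec l :: real^'n"]
        by (intro mult_left_mono) (auto simp: f_def n_def e_def)
      finally show ?thesis .
    qed
    show False
    \<comment> \<open>As e = 1/p, this separates p \<ge> 2 (focusing) from p < 2
      (spreading).\<close>
    proof (cases "e \<le> 1/2")
      case True
      define s where "s = m + n * (1/2 - e)"
      have s: "s > 0" using assms(2) True by (simp add: s_def n_def e_def)
      \<comment> \<open>The range allowed by \<open>cutoff_chirp_ge_focused\<close>. Being at most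
        1/2, it keeps [l - \<open>\<delta>\<close>, l + \<open>\<delta>\<close>] inside [l/2, 2l]
        for l \<ge> 1.\<close>
      define \<delta> where "\<delta> = 1 / (pi * (1 + a))"
      have "1 * 2 \<le> (1 + a) * pi" using a pi_gt3 by (intro mult_mono) auto
      hence \<delta>: "0 < \<delta>" "\<delta> \<le> 1/2" using a by (auto simp: \<delta>_def field_simps add_pos_pos)
      define D where "D = K * (exp (- pi) / 4) ^ CARD('n) * (2 * \<delta>) powr (n * e) * (2 * a) powr (n * (1/2 - e))"
      have "D > 0" using K(1) \<delta> a by (simp add: D_def)
      moreover have "D * l powr s \<le> C" if l: "l \<ge> 1" for l
      proof -
        define z where "z = 1 + 2 * \<i> * of_real (a * l)"
        have Rz: "Re z = 1" by (simp add: z_def)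
        have z_ge: "2 * a * l \<le> cmod z"
          using abs_Im_le_cmod[of z] a l by (simp add: z_def)
        have z_pos: "cmod z > 0" using Rz by auto
        have "exp (- pi) / 4 \<le> cmod (?I z l y)" if "l - \<delta> \<le> y" "y \<le> l + \<delta>" for y
        proof -
          have "z - 2 * \<i> * of_real (a * y) = 1 - 2 * \<i> * of_real (a * (y - l))"
            by (simp add: z_def algebra_simps)
          thus ?thesis
            using cutoff_chirp_ge_focused[OF \<psi>m \<psi> a, of "y - l"] that by (simp add: \<delta>_def abs_le_iff)
        qed
        hence "K * l powr m * (sqrt (cmod z) * (exp (- pi) / 4)) ^ CARD('n) * (l + \<delta> - (l - \<delta>)) powr (n * e)
            \<le> C * (cmod z / sqrt (Re z)) powr (n * e)"
          using l \<delta> Rz by (intro bound) auto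
        moreover have "(sqrt (cmod z) * (exp (- pi) / 4)) ^ CARD('n) = cmod z powr (n / 2) * (exp (- pi) / 4) ^ CARD('n)"
          using z_pos unfolding power_mult_distrib
          by (simp add: n_def powr_half_sqrt[symmetric] powr_powr flip: powr_realpow)
        ultimately have "(K * (exp (- pi) / 4) ^ CARD('n) * (2 * \<delta>) powr (n * e)) * l powr m * cmod z powr (n / 2)
            \<le> C * cmod z powr (n * e)"
          by (simp add: Rz mult_ac)
        hence "(K * (exp (- pi) / 4) ^ CARD('n) * (2 * \<delta>) powr (n * e)) * l powr m * cmod z powr (n / 2) / cmod z powr (n * e) \<le> C"
          using z_pos by (simp add: pos_divide_le_eq)
        moreover have "cmod z powr (n / 2) / cmod z powr (n * e) = cmod z powr (n * (1/2 - e))"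
          by (simp add: powr_diff[symmetric] algebra_simps)
        ultimately have "(K * (exp (- pi) / 4) ^ CARD('n) * (2 * \<delta>) powr (n * e)) * l powr m * cmod z powr (n * (1/2 - e)) \<le> C"
          by (metis times_divide_eq_right)
        \<comment> \<open>The case assumption makes this exponent nonnegative, so |z| \<ge> 2al may
          be inserted; the powers of l then combine to s.\<close>
        moreover have "(2 * a * l) powr (n * (1/2 - e)) \<le> cmod z powr (n * (1/2 - e))"
          using z_ge a l n True by (intro powr_mono2) auto
        hence "(K * (exp (- pi) / 4) ^ CARD('n) * (2 * \<delta>) powr (n * e)) * l powr m * (2 * a * l) powr (n * (1/2 - e)) \<le>
            (K * (exp (- pi) / 4) ^ CARD('n) * (2 * \<delta>) powr (n * e)) * l powr m * cmod z powr (n * (1/2 - e))"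
          using K(1) by (intro mult_left_mono mult_nonneg_nonneg) auto
        moreover have "(K * (exp (- pi) / 4) ^ CARD('n) * (2 * \<delta>) powr (n * e)) * l powr m * (2 * a * l) powr (n * (1/2 - e)) = D * l powr s"
          using a l by (simp add: D_def s_def powr_mult powr_add)
        ultimately show ?thesis by linarith
      qed
      hence "\<forall>\<^sub>F l in at_top. D * l powr s \<le> C"
        unfolding eventually_at_top_linorder by blast
      ultimately show False using powr_bounded_imp_nonpos s by fastforce
    next
      case False
      define s where "s = m + n * (e - 1/2)"
      have s: "s > 0" using assms(2) False by (simp add: s_def n_def e_def)
      \<comment> \<open>Chosen so that N s \<ge> n; with e \<le> 1 the final exponent N s + n/2 - n
        e is then at least n/2, hence positive.\<close>
      define N where "N = 1 + n / s"
      have N: "N \<ge> 1" "N * s \<ge> n" using s n by (auto simp: N_def field_simps)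
      define c where "c = sqrt (1 + 16 * a\<^sup>2) powr (- 1 / 2) * exp (- pi / (4 * a\<^sup>2))"
      have "sqrt (1 + 16 * a\<^sup>2) > 0" by (simp add: add_pos_nonneg)
      hence c: "c > 0" by (simp add: c_def)
      define D where "D = K * (c / 2) ^ CARD('n)"
      have "D > 0" using K(1) c by (simp add: D_def)
      moreover have "\<forall>\<^sub>F M in at_top. D * M powr (N * s + n / 2 - n * e) \<le> C"
      proof -
        \<comment> \<open>For l = M^N the main term is c M^(-N/2). The cutoff error is exponentially
          small in M, hence eventually at most half of it, which is why c / 2 appears in D.\<close>
        have "((\<lambda>M. exp (- pi * (M - 1) / 16) * M powr (N / 2)) \<longlongrightarrow> 0) at_top"
          using N(1) by real_asymp
        hence "\<forall>\<^sub>F M in at_top. exp (- pi * (M - 1) / 16) * M powr (N / 2) < c / 2"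
          using c by (intro order_tendstoD) auto
        thus ?thesis using eventually_ge_at_top[of "1::real"]
        proof eventually_elim
          case (elim M)
          define l where "l = M powr N"
          have l: "l \<ge> M" using elim(2) N(1) powr_mono[of 1 N M] by (simp add: l_def)
          hence l1: "l \<ge> 1" using elim by simp
          have sq: "sqrt M = M powr (1/2)" using elim by (simp add: powr_half_sqrt)
          have l2: "l powr (- 1 / 2) = M powr (- N / 2)" by (simp add: l_def powr_powr)
          have "exp (- pi * (M - 1) / 16) * M powr (N / 2) * M powr (- N / 2) \<le> c / 2 * M powr (- N / 2)"
            using elim by (intro mult_right_mono) auto
          hence small: "exp (- pi * (M - 1) / 16) \<le> c / 2 * l powr (- 1 / 2)"
            unfolding l2 using elim by (simp add: mult.assoc powr_add[symmetric])
          have "c / 2 * l powr (- 1 / 2) \<le> cmod (?I (of_real M) l y)"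
            if "l \<le> y" "y \<le> l + l / sqrt M" for y
            using cutoff_chirp_ge_spread[OF \<psi>m \<psi> a elim(2) l that] small unfolding c_def[symmetric] by simp
          moreover have "l / sqrt M \<le> l" using elim l1 by (simp add: divide_le_eq mult_le_cancel_left1)
          ultimately have "K * l powr m * (sqrt (cmod (of_real M)) * (c / 2 * l powr (- 1 / 2))) ^ CARD('n) *
              (l + l / sqrt M - l) powr (n * e) \<le> C * (cmod (of_real M) / sqrt (Re (of_real M))) powr (n * e)"
            using elim l1 c by (intro bound) auto
          moreover have "l powr m = M powr (N * m)" by (simp add: l_def powr_powr)
          moreover have "(sqrt (cmod (of_real M)) * (c / 2 * l powr (- 1 / 2))) ^ CARD('n) =
              (c / 2) ^ CARD('n) * M powr (n * (1/2 - N / 2))"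
          proof -
            have eq: "sqrt (cmod (of_real M)) * (c / 2 * l powr (- 1 / 2)) = c / 2 * M powr (1/2 - N / 2)"
              unfolding l2 using elim by (simp add: sq powr_add[symmetric])
            have "(M powr t) ^ CARD('n) = M powr (n * t)" for t
              using elim by (simp add: n_def powr_powr mult.commute flip: powr_realpow)
            thus ?thesis unfolding eq power_mult_distrib by simp
          qed
          moreover have "(l + l / sqrt M - l) powr (n * e) = M powr ((N - 1/2) * (n * e))"
            using elim by (simp add: sq l_def powr_diff[symmetric] powr_powr)
          moreover have "(cmod (of_real M) / sqrt (Re (of_real M))) powr (n * e) = M powr (n * e / 2)"
          proof -
            have "M / sqrt M = sqrt M" using elim by (simp add: real_div_sqrt)
            thus ?thesis using elim by (simp add: sq powr_powr)
          qed
          ultimately have "D * (M powr (N * m) * M powr (n * (1/2 - N / 2)) * M powr ((N - 1/2) * (n * e))) \<le>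
              C * M powr (n * e / 2)"
            by (simp add: D_def mult_ac)
          \<comment> \<open>The factors come from the weight, the d one-dimensional integrals and
            the cube of side l / sqrt M; M^(n e / 2) is split off to cancel the norm of f.\<close>
          also have "M powr (N * m) * M powr (n * (1/2 - N / 2)) * M powr ((N - 1/2) * (n * e)) =
              M powr (N * s + n / 2 - n * e) * M powr (n * e / 2)"
            unfolding powr_add[symmetric] by (rule arg_cong[of _ _ "(powr) M"]) (simp add: s_def field_simps)
          finally show ?case using elim by (simp add: mult.assoc[symmetric])
        qed
      qed
      ultimately have "N * s + n / 2 - n * e \<le> 0" by (rule powr_bounded_imp_nonpos)
      moreover have "n * e \<le> n * 1" using e n by (intro mult_left_mono) auto
      ultimately show False using N(2) n by linarith
    qed
  qed

  have "\<not> extends_to_bounded_operator_on \<infinity> schwartz_closure_Linf ?A" if "p = \<infinity>"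
  proof -
    \<comment> \<open>An essentially bounded Schwartz function approximates itself, so it lies in
      the closure.\<close>
    have "Lp_norm \<infinity> (\<lambda>x::real^'n. f x - f x) = 0" for f
      by (simp add: Lp_norm_def esssup_const)
    hence "schwartz \<inter> Lp_space \<infinity> \<subseteq> (schwartz_closure_Linf :: (real^'n \<Rightarrow> complex) set)"
      unfolding schwartz_closure_Linf_def by force
    thus ?thesis using no_extension[of schwartz_closure_Linf] that
      by (auto simp: schwartz_closure_Linf_def)
  qed
  moreover have "\<not> extends_to_bounded_operator_on p (Lp_space p) ?A"
    by (rule no_extension) auto
  ultimately show ?thesis
    using \<phi> \<sigma>_SG \<sigma>_supp by (intro exI[of _ \<phi>] exI[of _ \<sigma>]) (simp add: Let_def)
qed

end
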